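(* Let $p\in[1,\infty)$ and let $\mu,\nu\in P_p(\mathbb{R}^d)$ be two probability measures sharing the same copula. Denote by $F_i$ and $G_i$ ($i=1,\dots,d$) the distribution functions of the one-dimensional margins of $\mu$ and $\nu$, respectively. Then $$W_p^p(\mu,\nu)=\sum_{i=1}^d\int_{\mathbb{R}}\int_{\mathbb{R}}|x_i-y_i|^p\,dM(F_i(x_i),G_i(y_i))=\int_{[0,1]}\|F^{-1}(u)-G^{-1}(u)\|_p^p\,du,$$ where $M(a,b)=\min\{a,b\}$, $W_p$ is the Wasserstein distance of order $p$ on $(\mathbb{R}^d,\|\cdot\|_p)$, and for $u\in[0,1]$ $$F^{-1}(u)=(F_1^{-1}(u),\dots,F_d^{-1}(u)),\qquad G^{-1}(u)=(G_1^{-1}(u),\dots,G_d^{-1}(u)),$$ with $F_i^{-1}(u)=\inf\{x\in\mathbb{R}:F_i(x)\ge u\}$ and $G_i^{-1}(u)=\inf\{x\in\mathbb{R}:G_i(x)\ge u\}$ for $i=1,\dots,d$ (with the convention $\inf\emptyset=\infty$).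
   Context: $\|x\|_p=(\sum_{i=1}^d|x_i|^p)^{1/p}$ is the $p$-norm on $\mathbb{R}^d$. $P_p(\mathbb{R}^d)$ is the set of Borel probability measures on $\mathbb{R}^d$ with finite moment of order $p$. The Wasserstein distance is defined by $W_p^p(\mu,\nu)=\inf_{\pi\in\Pi(\mu,\nu)}\int_{\mathbb{R}^d\times\mathbb{R}^d}\|x-y\|_p^p\,\pi(dx,dy)$, where $\Pi(\mu,\nu)$ is the set of all couplings, i.e. Borel probability measures on $\mathbb{R}^d\times\mathbb{R}^d$ with first marginal $\mu$ and second marginal $\nu$. Distribution functions are right-continuous. A ($d$-dimensional) copula is a function $C:[0,1]^d\to[0,1]$ such that: (1) $C(u)=0$ whenever $u_i=0$ for some $i$; (2) for all $a,b\in[0,1]^d$ with $a_i\le b_i$ for all $i$, $\sum_{i_1=1}^2\cdots\sum_{i_d=1}^2(-1)^{i_1+\cdots+i_d}C(u_{1i_1},\dots,u_{di_d})\ge 0$, where $u_{j1}=a_j$ and $u_{j2}=b_j$; (3) $C(1,\dots,1,u_i,1,\dots,1)=u_i$ for all $i$ and all $u_i\in[0,1]$. The measures $\mu$ and $\nu$ share the same copula if there exists a $d$-dimensional copula $C$ such that the joint distribution functions $H_\mu(x)=\mu((-\infty,x_1]\times\cdots\times(-\infty,x_d])$ and $H_\nu(y)=\nu((-\infty,y_1]\times\cdots\times(-\infty,y_d])$ satisfy $H_\mu(x_1,\dots,x_d)=C(F_1(x_1),\dots,F_d(x_d))$ and $H_\nu(y_1,\dots,y_d)=C(G_1(y_1),\dots,G_d(y_d))$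 for all $x,y\in\mathbb{R}^d$. The notation $dM(F_i(x_i),G_i(y_i))$ denotes integration with respect to the Borel probability measure on $\mathbb{R}^2$ whose joint distribution function is $(x,y)\mapsto\min\{F_i(x),G_i(y)\}$. *)

theory Defs
  imports "HOL-Probability.Probability"
begin

definition pnorm :: "real \<Rightarrow> real ^ 'n \<Rightarrow> real" where
  "pnorm p x = (\<Sum>i\<in>UNIV. \<bar>x $ i\<bar> powr p) powr (1 / p)"

text \<open>The set \<open>P\<^sub>p\<close> of Borel probability measures with finite moment of order \<open>p\<close>.\<close>

definition prob_moment :: "real \<Rightarrow> (real ^ 'n) measure set" where
  "prob_moment p = {\<mu>. prob_space \<mu> \<and> sets \<mu> = sets borel \<and>
     integrable \<mu> (\<lambda>x. pnorm p x powr p)}"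

definition couplings ::
  "(real ^ 'n) measure \<Rightarrow> (real ^ 'n) measure \<Rightarrow> ((real ^ 'n) \<times> (real ^ 'n)) measure set" where
  "couplings \<mu> \<nu> = {\<pi>. prob_space \<pi> \<and> sets \<pi> = sets borel \<and>
     distr \<pi> borel fst = \<mu> \<and> distr \<pi> borel snd = \<nu>}"

text \<open>The infimum is taken in the extended nonnegative reals. It is finite on \<^term>\<open>prob_moment p\<close>
  (product coupling), so that \<^const>\<open>enn2real\<close> loses nothing there.\<close>

definition wasserstein :: "real \<Rightarrow> (real ^ 'n) measure \<Rightarrow> (real ^ 'n) measure \<Rightarrow> real" where
  "wasserstein p \<mu> \<nu> =
     enn2real (INF \<pi>\<in>couplings \<mu> \<nu>. \<integral>\<^sup>+(x, y). ennreal (pnorm p (x - y) powr p) \<partial>\<pi>) powr (1 / p)"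

definition joint_cdf :: "(real ^ 'n) measure \<Rightarrow> real ^ 'n \<Rightarrow> real" where
  "joint_cdf \<mu> x = measure \<mu> {y. \<forall>i. y $ i \<le> x $ i}"

definition margin_cdf :: "(real ^ 'n) measure \<Rightarrow> 'n \<Rightarrow> real \<Rightarrow> real" where
  "margin_cdf \<mu> i = cdf (distr \<mu> borel (\<lambda>x. x $ i))"

text \<open>A copula is represented by a total function of which only the values on the unit cube matter.
  In the third clause, a vertex of the box is indexed by \<open>k\<close>, with \<open>k j = 1\<close> selecting \<open>a $ j\<close>
  and \<open>k j = 2\<close> selecting \<open>b $ j\<close>.\<close>

definition copula :: "(real ^ 'n \<Rightarrow> real) \<Rightarrow> bool" where
  "copula C \<longleftrightarrow>
     (\<forall>u. (\<forall>j. u $ j \<in> {0..1}) \<longrightarrow> C u \<in> {0..1}) \<and>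
     (\<forall>u. (\<forall>j. u $ j \<in> {0..1}) \<longrightarrow> (\<exists>i. u $ i = 0) \<longrightarrow> C u = 0) \<and>
     (\<forall>a b. (\<forall>j. a $ j \<in> {0..1} \<and> b $ j \<in> {0..1} \<and> a $ j \<le> b $ j) \<longrightarrow>
        (\<Sum>k\<in>(UNIV :: 'n set) \<rightarrow>\<^sub>E {1, 2 :: nat}.
           (- 1) ^ (\<Sum>j\<in>UNIV. k j) * C (\<chi> j. if k j = 1 then a $ j else b $ j)) \<ge> 0) \<and>
     (\<forall>i. \<forall>t\<in>{0..1}. C (\<chi> j. if j = i then t else 1) = t)"

definition share_copula :: "(real ^ 'n) measure \<Rightarrow> (real ^ 'n) measure \<Rightarrow> bool" where
  "share_copula \<mu> \<nu> \<longleftrightarrow> (\<exists>C. copula C \<and>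
     (\<forall>x. joint_cdf \<mu> x = C (\<chi> i. margin_cdf \<mu> i (x $ i))) \<and>
     (\<forall>y. joint_cdf \<nu> y = C (\<chi> i. margin_cdf \<nu> i (y $ i))))"

text \<open>The Borel probability measure on the plane with joint distribution function
  \<open>H\<close>. The description is meaningful only if such a measure exists (it is then unique).\<close>

definition measure_of_cdf2 :: "(real \<Rightarrow> real \<Rightarrow> real) \<Rightarrow> (real \<times> real) measure" where
  "measure_of_cdf2 H = (THE m. prob_space m \<and> sets m = sets borel \<and>
     (\<forall>x y. measure m ({..x} \<times> {..y}) = H x y))"

text \<open>The infimum is taken in the extended reals, so the infimum of the empty set is \<open>\<infinity>\<close>.\<close>

definition quantile :: "(real \<Rightarrow> real) \<Rightarrow> real \<Rightarrow> ereal" where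
  "quantile F u = (INF x\<in>{x. u \<le> F x}. ereal x)"

text \<open>For a distribution function and \<open>0 < u < 1\<close> the quantile is finite; the infinite values
  possible at \<open>u = 0\<close> and \<open>u = 1\<close> are sent to \<open>0\<close> by \<^const>\<open>real_of_ereal\<close>.\<close>

definition quantile_vec :: "(real ^ 'n) measure \<Rightarrow> real \<Rightarrow> real ^ 'n" where
  "quantile_vec \<mu> u = (\<chi> i. real_of_ereal (quantile (margin_cdf \<mu> i) u))"

end

theory Submission
  imports Defs
begin

text \<open>The cost is a sum over coordinates, and every coordinate pair of a coupling of \<open>\<mu>\<close> and \<open>\<nu>\<close>
  couples the corresponding margins. On the line the comonotone coupling is optimal: \<open>\<bar>x - y\<bar> powr p\<close>
  is a mixture of the hinges \<open>max 0 (\<bar>x - y\<bar> - z)\<close>, a hinge is an integral of indicators of quadrants,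
  and the quadrant masses are extremal when the joint distribution function is the Frechet bound
  \<open>min F G\<close>. This gives the lower bound.

  For equality, let \<open>U\<close> be a random vector with distribution function \<open>C\<close>. Applying the marginal
  quantile functions of \<open>\<mu>\<close> and \<open>\<nu>\<close> to the same \<open>U\<close> yields a coupling all of whose coordinate
  pairs are comonotone. The vector \<open>U\<close> is built on the unit interval by repeatedly halving the cube,
  one coordinate at a time, and splitting the parameter interval in proportion to the \<open>C\<close>-volumes
  of the two halves.\<close>

section \<open>Volumes of boxes under a copula\<close>

text \<open>Box corners are plain functions, so that single coordinates can be changed by function update.\<close>

definition cvol :: "(real ^ 'n \<Rightarrow> real) \<Rightarrow> ('n \<Rightarrow> real) \<Rightarrow> ('n \<Rightarrow> real) \<Rightarrow> real" where
  "cvol C a b = (\<Sum>k\<in>(UNIV :: 'n set) \<rightarrow>\<^sub>E {1, 2 :: nat}.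
     (- 1) ^ (\<Sum>j\<in>UNIV. k j) * C (\<chi> j. if k j = 1 then a j else b j))"

text \<open>Vertices that differ only in coordinate \<open>i\<close> are paired; flipping
  \<open>k i\<close> from 1 to 2 reverses the sign. What remains is a signed sum of differences of
  \<open>C\<close> in that one coordinate.\<close>

lemma cvol_coordinate:
  fixes C :: "real ^ 'n \<Rightarrow> real" and i :: 'n
  shows "cvol C a b = (\<Sum>k\<in>{k \<in> (UNIV :: 'n set) \<rightarrow>\<^sub>E {1, 2 :: nat}. k i = 1}.
    (- 1) ^ (\<Sum>j\<in>UNIV. k j) *
      (C (\<chi> j. if j = i then a i else if k j = 1 then a j else b j) -
       C (\<chi> j. if j = i then b i else if k j = 1 then a j else b j)))"
proof -
  let ?K = "(UNIV :: 'n set) \<rightarrow>\<^sub>E {1, 2 :: nat}"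
  let ?K1 = "{k \<in> ?K. k i = 1}" and ?K2 = "{k \<in> ?K. k i = 2}"
  let ?t = "\<lambda>k. (- 1) ^ (\<Sum>j\<in>UNIV. k j) * C (\<chi> j. if k j = 1 then a j else b j)"
  have fin: "finite ?K" by (intro finite_PiE) auto
  have K: "?K = ?K1 \<union> ?K2" by (auto simp: PiE_def Pi_def)
  have bij: "bij_betw (\<lambda>k. k(i := 2)) ?K1 ?K2"
    by (rule bij_betw_byWitness[where f' = "\<lambda>k. k(i := 1)"])
       (auto simp: PiE_def Pi_def fun_upd_idem_iff, metis+)
  have flip: "?t (k(i := 2)) = - ((- 1) ^ (\<Sum>j\<in>UNIV. k j)) *
      C (\<chi> j. if j = i then b i else if k j = 1 then a j else b j)" if "k \<in> ?K1" for k
  proof -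
    have "(\<Sum>j\<in>UNIV. (k(i := 2)) j) = 2 + (\<Sum>j\<in>UNIV - {i}. k j)"
      by (subst sum.remove[of _ i]) auto
    moreover have "(\<Sum>j\<in>UNIV. k j) = 1 + (\<Sum>j\<in>UNIV - {i}. k j)"
      using that by (subst sum.remove[of _ i]) auto
    moreover have "(\<chi> j. if (k(i := 2)) j = 1 then a j else b j) =
        (\<chi> j. if j = i then b i else if k j = 1 then a j else b j)"
      by (auto simp: vec_eq_iff)
    ultimately show ?thesis by simp
  qed
  have "cvol C a b = sum ?t ?K1 + sum ?t ?K2"
    unfolding cvol_def by (subst K, rule sum.union_disjoint) (use fin in auto)
  also have "sum ?t ?K2 = (\<Sum>k\<in>?K1. ?t (k(i := 2)))"
    by (rule sum.reindex_bij_betw[OF bij, symmetric])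
  also have "\<dots> = (\<Sum>k\<in>?K1. - ((- 1) ^ (\<Sum>j\<in>UNIV. k j)) *
      C (\<chi> j. if j = i then b i else if k j = 1 then a j else b j))"
    by (rule sum.cong[OF refl flip])
  also have "sum ?t ?K1 = (\<Sum>k\<in>?K1. (- 1) ^ (\<Sum>j\<in>UNIV. k j) *
      C (\<chi> j. if j = i then a i else if k j = 1 then a j else b j))"
    by (intro sum.cong refl arg_cong2[where f = "(*)"] arg_cong[where f = C]) (auto simp: vec_eq_iff)
  finally show ?thesis by (simp add: sum.distrib[symmetric] algebra_simps)
qed

text \<open>In the form of \<open>cvol_coordinate\<close> each difference telescopes through the
  value at \<open>m\<close>. This additivity drives both the monotonicity estimates and the
  bisection.\<close>

lemma cvol_split:
  fixes C :: "real ^ 'n \<Rightarrow> real"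
  shows "cvol C a b = cvol C a (b(i := m)) + cvol C (a(i := m)) b"
proof -
  have e: "(\<chi> j. if j = i then x else if k j = 1 then (f(i := m)) j else g j) =
      (\<chi> j. if j = i then x else if k j = 1 then f j else g j)"
    "(\<chi> j. if j = i then x else if k j = 1 then f j else (g(i := m)) j) =
      (\<chi> j. if j = i then x else if k j = 1 then f j else g j)" for x k f g
    by (auto simp: vec_eq_iff)
  show ?thesis
    unfolding cvol_coordinate[where i = i] e fun_upd_same
    by (simp add: sum.distrib[symmetric] algebra_simps)
qed

text \<open>Splitting at the common value \<open>a i\<close> exhibits the volume as twice
  itself.\<close>

lemma cvol_degenerate: "a i = b i \<Longrightarrow> cvol C a b = 0"
  using cvol_split[of C a b i "a i"] by (metis fun_upd_triv add_cancel_right_right)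

lemma cvol_nonneg:
  assumes "copula C" "\<And>j. 0 \<le> a j" "\<And>j. a j \<le> b j" "\<And>j. b j \<le> 1"
  shows "0 \<le> cvol C a b"
proof -
  have "(\<forall>j. (\<chi> j. a j) $ j \<in> {0..1} \<and> (\<chi> j. b j) $ j \<in> {0..1} \<and> (\<chi> j. a j) $ j \<le> (\<chi> j. b j) $ j)"
    using assms by (auto intro: order_trans)
  moreover have "\<forall>a b. (\<forall>j. a $ j \<in> {0..1} \<and> b $ j \<in> {0..1} \<and> a $ j \<le> b $ j) \<longrightarrow>
      0 \<le> cvol C (\<lambda>j. a $ j) (\<lambda>j. b $ j)"
    using assms(1) unfolding copula_def cvol_def by blast
  ultimately have "0 \<le> cvol C (\<lambda>j. (\<chi> j. a j) $ j) (\<lambda>j. (\<chi> j. b j) $ j)" by blast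
  then show ?thesis by simp
qed

text \<open>Groundedness kills every vertex having a coordinate 0. Only the upper corner survives,
  with positive sign because each coordinate contributes 2 to the exponent.\<close>

lemma cvol_lower_zero:
  assumes "copula C" "\<And>j. 0 \<le> u j" "\<And>j. u j \<le> 1"
  shows "cvol C (\<lambda>_. 0) u = C (\<chi> j. u j)"
proof -
  let ?K = "(UNIV :: 'a set) \<rightarrow>\<^sub>E {1, 2 :: nat}"
  let ?t = "\<lambda>k. (- 1) ^ (\<Sum>j\<in>UNIV. k j) * C (\<chi> j. if k j = 1 then 0 else u j)"
  have grounded: "C v = 0" if "\<forall>j. v $ j \<in> {0..1}" "\<exists>j. v $ j = 0" for v
    using assms(1) that unfolding copula_def by blast
  have "sum ?t ?K = ?t (\<lambda>_. 2)"
  proof (subst sum.remove[of _ "\<lambda>_. 2"])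
    show "finite ?K" by (intro finite_PiE) auto
    have "?t k = 0" if k: "k \<in> ?K - {\<lambda>_. 2}" for k
    proof -
      obtain j where "k j \<noteq> 2" using k by auto
      with k have "k j = 1" by (auto simp: PiE_def Pi_def)
      then show ?thesis using assms by (subst grounded) auto
    qed
    then show "?t (\<lambda>_. 2) + sum ?t (?K - {\<lambda>_. 2}) = ?t (\<lambda>_. 2)" by simp
  qed auto
  then show ?thesis by (simp add: cvol_def mult.commute[of _ 2] power_mult)
qed

text \<open>Truncation at \<open>t\<close> either leaves the box alone, cuts off a sub-box of
  nonnegative volume, or collapses it to a degenerate box.\<close>

lemma cvol_min_coordinate_le:
  assumes C: "copula C" and a: "\<And>j. 0 \<le> a j" "\<And>j. a j \<le> b j" "\<And>j. b j \<le> 1"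
    and t: "0 \<le> t"
  shows "cvol C (a(i := min (a i) t)) (b(i := min (b i) t)) \<le> cvol C a b"
proof -
  consider "b i \<le> t" | "a i \<le> t" "t \<le> b i" | "t < a i" by linarith
  then show ?thesis
  proof cases
    case 1
    with a(2)[of i] show ?thesis by (simp add: min_absorb1)
  next
    case 2
    have "0 \<le> cvol C (a(i := t)) b"
      using a t 2 by (intro cvol_nonneg[OF C]) auto
    with 2 cvol_split[of C a b i t] show ?thesis by (simp add: min_absorb1 min_absorb2)
  next
    case 3
    with a(2)[of i] have "cvol C (a(i := min (a i) t)) (b(i := min (b i) t)) = 0"
      by (intro cvol_degenerate[of _ i]) auto
    with cvol_nonneg[OF C a] show ?thesis by simp
  qed
qed

lemma cvol_min_le:
  fixes C :: "real ^ 'n \<Rightarrow> real"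
  assumes C: "copula C" and a: "\<And>j. 0 \<le> a j" "\<And>j. a j \<le> b j" "\<And>j. b j \<le> 1"
    and u: "\<And>j. 0 \<le> u j"
  shows "cvol C (\<lambda>j. min (a j) (u j)) (\<lambda>j. min (b j) (u j)) \<le> cvol C a b"
proof -
  \<comment> \<open>Truncating only the coordinates in \<open>S\<close> allows an induction that
    adds one coordinate at a time.\<close>
  let ?m = "\<lambda>S a j. if j \<in> S then min (a j) (u j) else a j :: real"
  have "cvol C (?m S a) (?m S b) \<le> cvol C a b" if "finite S" for S
    using that
  proof (induction S rule: finite_induct)
    case (insert i S)
    have "?m (insert i S) f = (?m S f)(i := min (?m S f i) (u i))" for f
      using insert.hyps(2) by (simp add: fun_eq_iff)
    moreover have "cvol C ((?m S a)(i := min (?m S a i) (u i))) ((?m S b)(i := min (?m S b i) (u i)))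
        \<le> cvol C (?m S a) (?m S b)"
    proof (rule cvol_min_coordinate_le[OF C])
      fix j
      show "0 \<le> ?m S a j" "?m S a j \<le> ?m S b j" "?m S b j \<le> 1"
        using a[of j] u[of j] by (simp_all add: min_le_iff_disj)
    qed (rule u)
    ultimately show ?case using insert.IH by (metis (no_types, lifting) order_trans)
  qed simp
  from this[of UNIV] show ?thesis by simp
qed

section \<open>The probability measure of a copula\<close>

type_synonym 'n cell = "('n \<Rightarrow> real) \<times> ('n \<Rightarrow> real) \<times> real"

text \<open>A cell \<open>(a, b, s)\<close> stands for the box with corners \<open>a\<close> and \<open>b\<close> together with the
  parameter interval \<open>[s, s + cvol C a b)\<close>. A parameter \<open>\<omega>\<close> selects the half of the box whose
  parameter interval contains it.\<close>

fun bisect :: "(real ^ 'n \<Rightarrow> real) \<Rightarrow> 'n \<Rightarrow> real \<Rightarrow> 'n cell \<Rightarrow> 'n cell" where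
  "bisect C i \<omega> (a, b, s) =
     (let m = (a i + b i) / 2; v = cvol C a (b(i := m))
      in if \<omega> < s + v then (a, b(i := m), s) else (a(i := m), b, s + v))"

text \<open>The schedule \<open>c\<close> names the coordinate halved at each time, starting with
  time \<open>j\<close>. The first bisection is peeled off first, so that inductions can vary the
  starting cell; \<open>descend_Suc_last\<close> gives the opposite view.\<close>

primrec descend :: "(real ^ 'n \<Rightarrow> real) \<Rightarrow> (nat \<Rightarrow> 'n) \<Rightarrow> nat \<Rightarrow> nat \<Rightarrow> 'n cell \<Rightarrow> real \<Rightarrow> 'n cell" where
  "descend C c j 0 x \<omega> = x"
| "descend C c j (Suc n) x \<omega> = descend C c (Suc j) n (bisect C (c j) \<omega> x) \<omega>"

lemma descend_Suc_last: "descend C c j (Suc n) x \<omega> = bisect C (c (j + n)) \<omega> (descend C c j n x \<omega>)"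
  by (induction n arbitrary: j x) simp_all

text \<open>The parameter enters only through finitely many comparisons, so the result is a step
  function of it, whatever \<open>g\<close> is. Composing with a real function avoids putting a
  sigma-algebra on cells.\<close>

lemma measurable_descend:
  "(\<lambda>\<omega>. (g :: _ \<Rightarrow> real) (descend C c j n x \<omega>)) \<in> borel_measurable borel"
proof (induction n arbitrary: j x)
  case (Suc n)
  obtain a b s where x: "x = (a, b, s)" by (cases x)
  let ?m = "(a (c j) + b (c j)) / 2"
  let ?v = "cvol C a (b(c j := ?m))"
  have "(\<lambda>\<omega>. g (descend C c j (Suc n) x \<omega>)) =
      (\<lambda>\<omega>. if \<omega> < s + ?v then g (descend C c (Suc j) n (a, b(c j := ?m), s) \<omega>)
           else g (descend C c (Suc j) n (a(c j := ?m), b, s + ?v) \<omega>))"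
    by (auto simp: x Let_def fun_eq_iff)
  then show ?case
    using Suc by simp
qed simp

definition cell_ok :: "('n \<Rightarrow> real) \<Rightarrow> ('n \<Rightarrow> real) \<Rightarrow> bool" where
  "cell_ok a b \<longleftrightarrow> (\<forall>j. 0 \<le> a j \<and> a j \<le> b j \<and> b j \<le> 1)"

text \<open>The fraction of the \<open>C\<close>-mass of a cell that lies below \<open>u\<close>, a
  conditional probability: taking minima with \<open>u\<close> intersects the box with a lower
  orthant. A cell of volume 0 gets ratio 0.\<close>

definition ratio :: "(real ^ 'n \<Rightarrow> real) \<Rightarrow> ('n \<Rightarrow> real) \<Rightarrow> 'n cell \<Rightarrow> real" where
  "ratio C u = (\<lambda>(a, b, s). cvol C (\<lambda>j. min (a j) (u j)) (\<lambda>j. min (b j) (u j)) / cvol C a b)"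

lemma cell_ok_bisect:
  assumes "cell_ok a b"
  shows "cell_ok a (b(i := (a i + b i) / 2))" "cell_ok (a(i := (a i + b i) / 2)) b"
  using assms unfolding cell_ok_def
  by (auto simp: field_simps) (smt (verit) assms cell_ok_def)+

lemma cvol_cell:
  assumes "copula C" "cell_ok a b" "\<And>j. 0 \<le> u j"
  shows "0 \<le> cvol C a b" "0 \<le> cvol C (\<lambda>j. min (a j) (u j)) (\<lambda>j. min (b j) (u j))"
    "cvol C (\<lambda>j. min (a j) (u j)) (\<lambda>j. min (b j) (u j)) \<le> cvol C a b"
proof -
  have ab: "0 \<le> a j" "a j \<le> b j" "b j \<le> 1" for j
    using assms(2) by (auto simp: cell_ok_def)
  show "0 \<le> cvol C a b" by (rule cvol_nonneg[OF assms(1) ab])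
  show "cvol C (\<lambda>j. min (a j) (u j)) (\<lambda>j. min (b j) (u j)) \<le> cvol C a b"
    by (rule cvol_min_le[OF assms(1) ab assms(3)])
  show "0 \<le> cvol C (\<lambda>j. min (a j) (u j)) (\<lambda>j. min (b j) (u j))"
  proof (rule cvol_nonneg[OF assms(1)])
    fix j show "0 \<le> min (a j) (u j)" "min (a j) (u j) \<le> min (b j) (u j)" "min (b j) (u j) \<le> 1"
      using ab[of j] assms(3)[of j] by auto
  qed
qed

text \<open>By \<open>cvol_split\<close> the two halves divide the parameter interval exactly, and
  the comparison in \<open>bisect\<close> chooses the piece holding \<open>\<omega>\<close>. In
  particular the selected cell has positive volume.\<close>

lemma descend_invariant:
  assumes "copula C" "cell_ok a b" "s \<le> \<omega>" "\<omega> < s + cvol C a b"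
    and "descend C c j n (a, b, s) \<omega> = (a', b', s')"
  shows "cell_ok a' b' \<and> s' \<le> \<omega> \<and> \<omega> < s' + cvol C a' b'"
  using assms(2-)
proof (induction n arbitrary: j a b s)
  case (Suc n)
  let ?i = "c j"
  let ?m = "(a ?i + b ?i) / 2"
  have "cvol C a b = cvol C a (b(?i := ?m)) + cvol C (a(?i := ?m)) b"
    by (rule cvol_split)
  note ok = cell_ok_bisect[OF Suc.prems(1), of ?i]
  show ?case
  proof (cases "\<omega> < s + cvol C a (b(?i := ?m))")
    case True
    with Suc.prems show ?thesis
      by (intro Suc.IH[of a "b(?i := ?m)" s "Suc j"] ok) (simp_all add: Let_def del: fun_upd_apply)
  next
    case False
    with Suc.prems \<open>cvol C a b = _\<close> show ?thesis
      by (intro Suc.IH[of "a(?i := ?m)" b "s + cvol C a (b(?i := ?m))" "Suc j"] ok)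
        (simp_all add: Let_def del: fun_upd_apply)
  qed
qed auto

text \<open>Conditionally on the current cell, the ratio is a martingale.\<close>

lemma nn_integral_ratio_descend:
  assumes C: "copula C" and u: "\<And>j. 0 \<le> u j" and ok: "cell_ok a b"
  shows "(\<integral>\<^sup>+\<omega>. ennreal (ratio C u (descend C c j n (a, b, s) \<omega>)) * indicator {s..<s + cvol C a b} \<omega> \<partial>lborel)
    = ennreal (cvol C (\<lambda>j. min (a j) (u j)) (\<lambda>j. min (b j) (u j)))"
  using ok
proof (induction n arbitrary: j a b s)
  case 0
  note le = cvol_cell[where u = u, OF C 0 u]
  have "(\<integral>\<^sup>+\<omega>. ennreal (ratio C u (descend C c j 0 (a, b, s) \<omega>)) * indicator {s..<s + cvol C a b} \<omega> \<partial>lborel)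
      = ennreal (ratio C u (a, b, s)) * ennreal (cvol C a b)"
    using le by (simp add: nn_integral_cmult)
  also have "\<dots> = ennreal (ratio C u (a, b, s) * cvol C a b)"
    using le by (intro ennreal_mult[symmetric]) (auto simp: ratio_def)
  \<comment> \<open>Division by zero is harmless: the truncated volume lies between 0 and
    \<open>cvol C a b\<close>, so it vanishes with it.\<close>
  also have "ratio C u (a, b, s) * cvol C a b = cvol C (\<lambda>j. min (a j) (u j)) (\<lambda>j. min (b j) (u j))"
    using le by (auto simp: ratio_def)
  finally show ?case .
next
  case (Suc n)
  let ?i = "c j"
  let ?m = "(a ?i + b ?i) / 2"
  let ?f = "\<lambda>a b. cvol C (\<lambda>j. min (a j) (u j)) (\<lambda>j. min (b j) (u j))"
  let ?vl = "cvol C a (b(?i := ?m))" and ?vr = "cvol C (a(?i := ?m)) b"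
  let ?L = "(a, b(?i := ?m), s)" and ?R = "(a(?i := ?m), b, s + ?vl)"
  let ?r = "\<lambda>x \<omega>. ennreal (ratio C u (descend C c (Suc j) n x \<omega>))"
  note okl = cell_ok_bisect(1)[OF Suc.prems, of ?i] and okr = cell_ok_bisect(2)[OF Suc.prems, of ?i]
  note vl = cvol_cell[where u = u, OF C okl u] and vr = cvol_cell[where u = u, OF C okr u]
  have v: "cvol C a b = ?vl + ?vr" by (rule cvol_split)
  \<comment> \<open>Truncation turns the cut at \<open>?m\<close> into a cut at
    \<open>min ?m (u ?i)\<close>, so truncated volumes are additive as well.\<close>
  have f: "?f a b = ?f a (b(?i := ?m)) + ?f (a(?i := ?m)) b"
  proof -
    have "(\<lambda>j. min ((g(?i := ?m)) j) (u j)) = (\<lambda>j. min (g j) (u j))(?i := min ?m (u ?i))" for g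
      by (simp add: fun_eq_iff)
    then show ?thesis by (simp only:) (rule cvol_split)
  qed
  \<comment> \<open>The parameter intervals of the two halves are adjacent and disjoint, and on each
    of them \<open>bisect\<close> makes a constant choice.\<close>
  have "ennreal (ratio C u (descend C c j (Suc n) (a, b, s) \<omega>)) * indicator {s..<s + cvol C a b} \<omega>
      = ?r ?L \<omega> * indicator {s..<s + ?vl} \<omega> + ?r ?R \<omega> * indicator {s + ?vl..<s + ?vl + ?vr} \<omega>" for \<omega>
    using vl(1) vr(1) unfolding v by (auto simp: Let_def indicator_def)
  then have "(\<integral>\<^sup>+\<omega>. ennreal (ratio C u (descend C c j (Suc n) (a, b, s) \<omega>)) * indicator {s..<s + cvol C a b} \<omega> \<partial>lborel)
      = (\<integral>\<^sup>+\<omega>. ?r ?L \<omega> * indicator {s..<s + ?vl} \<omega> + ?r ?R \<omega> * indicator {s + ?vl..<s + ?vl + ?vr} \<omega> \<partial>lborel)"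
    by simp
  also have "\<dots> = (\<integral>\<^sup>+\<omega>. ?r ?L \<omega> * indicator {s..<s + ?vl} \<omega> \<partial>lborel)
      + (\<integral>\<^sup>+\<omega>. ?r ?R \<omega> * indicator {s + ?vl..<s + ?vl + ?vr} \<omega> \<partial>lborel)"
    by (intro nn_integral_add) (auto intro!: borel_measurable_times_ennreal measurable_compose[OF measurable_descend measurable_ennreal])
  also have "\<dots> = ennreal (?f a (b(?i := ?m))) + ennreal (?f (a(?i := ?m)) b)"
    by (intro arg_cong2[where f = "(+)"] Suc.IH okl okr)
  also have "\<dots> = ennreal (?f a b)"
    unfolding f by (rule ennreal_plus[symmetric, OF vl(2) vr(2)])
  finally show ?case .
qed

lemma bisect_nested:
  assumes "cell_ok a b" "bisect C i \<omega> (a, b, s) = (a', b', s')"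
  shows "cell_ok a' b' \<and> a j \<le> a' j \<and> b' j \<le> b j \<and>
    b' j - a' j = (b j - a j) * (if i = j then 1 / 2 else 1)"
proof -
  note ok = cell_ok_bisect[OF assms(1), of i]
  have "a i \<le> b i" using assms(1) by (simp add: cell_ok_def)
  with assms(2) ok show ?thesis
    by (auto simp: Let_def field_simps simp del: fun_upd_apply split: if_split_asm)
       (auto simp: field_simps)
qed

section \<open>Schedules of coordinates and shrinking widths\<close>

text \<open>Time \<open>prod_encode (to_nat i, m)\<close> is assigned to \<open>i\<close> for every
  \<open>m\<close>. As a schedule this halves every coordinate infinitely often, so the boxes shrink
  to points.\<close>

lemma infinitely_recurring_enumeration:
  obtains c :: "nat \<Rightarrow> 'n :: countable" where "\<And>i. infinite {j. c j = i}"
proof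
  fix i :: 'n
  have "range (\<lambda>m. prod_encode (to_nat i, m)) \<subseteq> {j. from_nat (fst (prod_decode j)) = i}"
    by auto
  moreover have "infinite (range (\<lambda>m. prod_encode (to_nat i, m)))"
    by (intro range_inj_infinite injI) (simp add: prod_encode_eq)
  ultimately show "infinite {j. (from_nat (fst (prod_decode j)) :: 'n) = i}"
    using finite_subset by blast
qed

text \<open>An infinite set has subsets of every finite size, so the exponent tends to infinity.
  With \<open>S\<close> the times at which a coordinate is halved, the power is the width of the box
  in that coordinate.\<close>

lemma half_power_card_tendsto_0:
  fixes S :: "nat set"
  assumes "infinite S"
  shows "(\<lambda>n. (1 / 2 :: real) ^ card (S \<inter> {..<n})) \<longlonglongrightarrow> 0"
proof -
  have "filterlim (\<lambda>n. card (S \<inter> {..<n})) at_top sequentially"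
  proof (unfold filterlim_at_top, safe)
    fix Z :: nat
    obtain T where T: "finite T" "card T = Z" "T \<subseteq> S"
      using infinite_arbitrarily_large[OF assms] by blast
    from T(1) obtain N where N: "T \<subseteq> {..<N}"
      by (meson finite_nat_iff_bounded)
    show "\<forall>\<^sub>F n in sequentially. Z \<le> card (S \<inter> {..<n})"
      using eventually_ge_at_top[of N]
    proof eventually_elim
      case (elim n)
      with N T(3) have "T \<subseteq> S \<inter> {..<n}" by auto
      then show ?case using card_mono[of "S \<inter> {..<n}" T] T(2) by simp
    qed
  qed
  from filterlim_compose[OF LIMSEQ_realpow_zero[of "1 / 2"] this] show ?thesis by simp
qed

lemma measurable_vec_lambda:
  fixes f :: "'a \<Rightarrow> 'n :: finite \<Rightarrow> real"
  assumes "\<And>i. (\<lambda>x. f x i) \<in> borel_measurable M"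
  shows "(\<lambda>x. \<chi> i. f x i) \<in> borel_measurable M"
  using assms by (subst borel_measurable_euclidean_space) (auto simp: Basis_vec_def inner_axis)

lemma measurable_vec_nth [measurable]: "(\<lambda>x :: real ^ 'n. x $ i) \<in> borel_measurable borel"
  by (intro borel_measurable_continuous_onI continuous_intros)

lemma copula_margin: "copula C \<Longrightarrow> t \<in> {0..1} \<Longrightarrow> C (\<chi> j. if j = i then t else 1) = t"
  unfolding copula_def by blast

text \<open>The limit point \<open>U\<close> of the nested boxes selected by a uniform parameter has the required law,
  up to the boundary of the orthant; the boundary is shown to be null afterwards, because the
  bounds applied to the margins already force these to be uniform.\<close>

lemma ex_measure_sandwich_copula:
  fixes C :: "real ^ 'n \<Rightarrow> real"
  assumes C: "copula C"
  obtains P :: "(real ^ 'n) measure" where "prob_space P" "sets P = sets borel"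
    "\<And>u. (\<And>j. u j \<in> {0..1}) \<Longrightarrow> measure P {x. \<forall>j. x $ j < u j \<or> u j = 1} \<le> C (\<chi> j. u j)"
    "\<And>u. (\<And>j. u j \<in> {0..1}) \<Longrightarrow> C (\<chi> j. u j) \<le> measure P {x. \<forall>j. x $ j \<le> u j}"
proof -
  obtain c :: "nat \<Rightarrow> 'n" where c: "infinite {m. c m = i}" for i
    using infinitely_recurring_enumeration by blast
  \<comment> \<open>The initial cell is the unit cube; its parameter interval is [0, 1) because its
    volume is 1, shown as \<open>one\<close> below.\<close>
  define D where "D n \<omega> = descend C c 0 n (\<lambda>_. 0, \<lambda>_. 1, 0) \<omega>" for n \<omega>
  define lo where "lo n \<omega> = fst (D n \<omega>)" for n \<omega>
  define hi where "hi n \<omega> = fst (snd (D n \<omega>))" for n \<omega>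
  define pos where "pos n \<omega> = snd (snd (D n \<omega>))" for n \<omega>
  have D: "D n \<omega> = (lo n \<omega>, hi n \<omega>, pos n \<omega>)" for n \<omega>
    by (simp add: lo_def hi_def pos_def)
  have D_Suc: "D (Suc n) \<omega> = bisect C (c n) \<omega> (D n \<omega>)" for n \<omega>
    unfolding D_def descend_Suc_last by simp
  have ok: "cell_ok (lo n \<omega>) (hi n \<omega>)" for n \<omega>
  proof (induction n)
    case 0
    then show ?case by (simp add: lo_def hi_def D_def cell_ok_def)
  next
    case (Suc n)
    show ?case using bisect_nested[OF Suc, of C "c n" \<omega>] D_Suc[of n \<omega>] unfolding D by metis
  qed
  have nested: "lo n \<omega> j \<le> lo (Suc n) \<omega> j" "hi (Suc n) \<omega> j \<le> hi n \<omega> j"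
    "hi (Suc n) \<omega> j - lo (Suc n) \<omega> j = (hi n \<omega> j - lo n \<omega> j) * (if c n = j then 1 / 2 else 1)" for n \<omega> j
    using bisect_nested[OF ok, of C "c n" \<omega> n \<omega> _ _ _ _ j] D_Suc[of n \<omega>] unfolding D by metis+
  have width: "hi n \<omega> j - lo n \<omega> j = (1 / 2) ^ card ({m. c m = j} \<inter> {..<n})" for n \<omega> j
  proof (induction n)
    case 0
    then show ?case by (simp add: lo_def hi_def D_def)
  next
    case (Suc n)
    then show ?case by (simp add: nested(3) lessThan_Suc Int_insert_right)
  qed
  have inc: "incseq (\<lambda>n. lo n \<omega> j)" and dec: "decseq (\<lambda>n. hi n \<omega> j)" for \<omega> j
    using nested by (auto intro: incseq_SucI decseq_SucI)
  have bounds: "0 \<le> lo n \<omega> j" "lo n \<omega> j \<le> hi n \<omega> j" "hi n \<omega> j \<le> 1" for n \<omega> j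
    using ok[of n \<omega>] by (auto simp: cell_ok_def)
  define U where "U \<omega> j = lim (\<lambda>n. lo n \<omega> j)" for \<omega> j
  have lo_U: "(\<lambda>n. lo n \<omega> j) \<longlonglongrightarrow> U \<omega> j" for \<omega> j
  proof -
    have "convergent (\<lambda>n. lo n \<omega> j)"
      using incseq_convergent[OF inc, of \<omega> j 1] bounds by (meson convergentI order_trans)
    then show ?thesis by (simp add: U_def convergent_LIMSEQ_iff)
  qed
  have hi_U: "(\<lambda>n. hi n \<omega> j) \<longlonglongrightarrow> U \<omega> j" for \<omega> j
    using tendsto_add[OF lo_U half_power_card_tendsto_0[OF c[of j]], of \<omega> j]
    unfolding width[of _ \<omega> j, symmetric] by simp

  let ?\<Omega> = "restrict_space lborel {0..<1 :: real}"
  interpret \<Omega>: prob_space ?\<Omega>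
    by (auto simp: space_restrict_space emeasure_restrict_space intro!: prob_spaceI)
  have [measurable]: "(\<lambda>\<omega>. lo n \<omega> j) \<in> borel_measurable borel" for n j
    unfolding lo_def D_def by (rule measurable_descend)
  have [measurable]: "(\<lambda>\<omega>. U \<omega> j) \<in> borel_measurable borel" for j
    by (rule borel_measurable_LIMSEQ_real[OF lo_U]) simp
  have U_meas: "(\<lambda>\<omega>. \<chi> j. U \<omega> j) \<in> measurable ?\<Omega> borel"
    by (intro measurable_vec_lambda measurable_restrict_space1) simp

  define P where "P = distr ?\<Omega> borel (\<lambda>\<omega>. \<chi> j. U \<omega> j)"
  have P: "prob_space P" unfolding P_def by (rule \<Omega>.prob_space_distr[OF U_meas])
  have measure_P: "measure P {x. \<forall>j. Q j (x $ j)} = measure ?\<Omega> {\<omega> \<in> {0..<1}. \<forall>j. Q j (U \<omega> j)}"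
    if "\<And>j. Measurable.pred borel (Q j)" for Q
  proof -
    have "{x :: real ^ 'n. \<forall>j. Q j (x $ j)} \<in> sets borel"
    proof -
      have "Measurable.pred borel (\<lambda>x :: real ^ 'n. \<forall>j. Q j (x $ j))"
        by (intro pred_intros_countable measurable_compose[OF measurable_vec_nth that])
      then show ?thesis by (simp add: pred_def)
    qed
    then show ?thesis
      unfolding P_def by (subst measure_distr[OF U_meas])
        (auto simp: space_restrict_space intro!: arg_cong[where f = "measure ?\<Omega>"])
  qed

  have sandwich: "measure P {x. \<forall>j. x $ j < u j \<or> u j = 1} \<le> C (\<chi> j. u j)"
    "C (\<chi> j. u j) \<le> measure P {x. \<forall>j. x $ j \<le> u j}" if u: "\<And>j. u j \<in> {0..1}" for u :: "'n \<Rightarrow> real"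
  proof -
    have u0: "\<And>j. 0 \<le> u j" and u1: "\<And>j. u j \<le> 1" using u by auto
    \<comment> \<open>For every \<open>n\<close> the mean of \<open>g n\<close> is
      \<open>C (\<chi> j. u j)\<close>. Since \<open>g n\<close> tends to 1 on \<open>?A\<close> and
      to 0 off \<open>?B\<close>, dominated convergence places this value between the measures of
      \<open>?A\<close> and \<open>?B\<close>.\<close>
    define g where "g n \<omega> = ratio C u (D n \<omega>)" for n \<omega>
    have [measurable]: "g n \<in> borel_measurable borel" for n
      unfolding g_def D_def by (rule measurable_descend)
    have gm [measurable]: "g n \<in> borel_measurable ?\<Omega>" for n
      by (intro measurable_restrict_space1) simp
    note cell = cvol_cell[where u = u, OF C ok u0]
    have g: "0 \<le> g n \<omega>" "g n \<omega> \<le> 1" for n \<omega>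
      using cell[of n \<omega>] by (auto simp: g_def ratio_def D divide_le_eq_1)
    have ok0: "cell_ok (\<lambda>_ :: 'n. 0) (\<lambda>_. 1)" by (simp add: cell_ok_def)
    have one: "cvol C (\<lambda>_. 0) (\<lambda>_. 1) = 1"
    proof -
      \<comment> \<open>The margin clause at the value 1, in an arbitrary coordinate
        \<open>undefined\<close>.\<close>
      have "C (\<chi> j. 1) = 1"
        using copula_margin[OF C, of 1 undefined] by simp
      then show ?thesis by (simp add: cvol_lower_zero[OF C])
    qed
    have int_g: "integral\<^sup>L ?\<Omega> (g n) = C (\<chi> j. u j)" for n
    proof -
      have "integral\<^sup>L ?\<Omega> (g n) = enn2real (\<integral>\<^sup>+\<omega>. ennreal (g n \<omega>) \<partial>?\<Omega>)"
        by (rule integral_eq_nn_integral) (use g in auto)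
      also have "(\<integral>\<^sup>+\<omega>. ennreal (g n \<omega>) \<partial>?\<Omega>) =
          (\<integral>\<^sup>+\<omega>. ennreal (g n \<omega>) * indicator {0..<0 + cvol C (\<lambda>_. 0) (\<lambda>_. 1)} \<omega> \<partial>lborel)"
        unfolding one by (subst nn_integral_restrict_space) auto
      also have "\<dots> = ennreal (cvol C (\<lambda>j. min 0 (u j)) (\<lambda>j. min 1 (u j)))"
        unfolding g_def D_def by (rule nn_integral_ratio_descend[OF C u0 ok0])
      also have "cvol C (\<lambda>j. min 0 (u j)) (\<lambda>j. min 1 (u j)) = C (\<chi> j. u j)"
        using u0 u1 cvol_lower_zero[OF C u0 u1] by (simp add: min_absorb1 min_absorb2)
      finally show ?thesis
        using C u unfolding copula_def by simp
    qed
    let ?A = "{\<omega> \<in> {0..<1}. \<forall>j. U \<omega> j < u j \<or> u j = 1}"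
    let ?B = "{\<omega> \<in> {0..<1}. \<forall>j. U \<omega> j \<le> u j}"
    have Am: "?A \<in> sets ?\<Omega>" and Bm: "?B \<in> sets ?\<Omega>"
      by (auto simp: sets_restrict_space_iff)
    have Bc: "{0..<1} - ?B \<in> sets ?\<Omega>"
      using sets.compl_sets[OF Bm] by (simp add: space_restrict_space)
    have int_ind: "integrable ?\<Omega> (\<lambda>\<omega>. g n \<omega> * indicator S \<omega>)" if "S \<in> sets ?\<Omega>" for n S
      using that g by (intro \<Omega>.integrable_const_bound[where B = 1]) (auto simp: indicator_def)
    have int: "integrable ?\<Omega> (g n)" for n
      using g by (intro \<Omega>.integrable_const_bound[where B = 1]) auto
    have int_B: "integrable ?\<Omega> (indicator ?B :: real \<Rightarrow> real)"
      using Bm by (intro integrable_real_indicator) (simp_all add: \<Omega>.emeasure_eq_measure)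
    \<comment> \<open>Eventually the whole cell lies below \<open>u\<close>; where
      \<open>u j = 1\<close> this holds from the start, as cells lie in the unit cube. Truncation
      then changes nothing, and positive volume makes the ratio exactly 1.\<close>
    have lim_A: "(\<lambda>n. g n \<omega>) \<longlonglongrightarrow> 1" if "\<omega> \<in> ?A" for \<omega>
    proof (rule tendsto_eventually)
      have "\<forall>\<^sub>F n in sequentially. hi n \<omega> j \<le> u j" for j
      proof (cases "u j = 1")
        case True then show ?thesis using bounds by simp
      next
        case False
        with that have "U \<omega> j < u j" by auto
        from order_tendstoD(2)[OF hi_U this] show ?thesis by eventually_elim simp
      qed
      then have "\<forall>\<^sub>F n in sequentially. \<forall>j. hi n \<omega> j \<le> u j"
        by (rule eventually_all_finite)
      then show "\<forall>\<^sub>F n in sequentially. g n \<omega> = 1"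
      proof eventually_elim
        case (elim n)
        have "\<omega> < pos n \<omega> + cvol C (lo n \<omega>) (hi n \<omega>) \<and> pos n \<omega> \<le> \<omega>"
          using descend_invariant[OF C ok0, of 0 \<omega> c 0 n] that D[of n \<omega>] one
          unfolding D_def by auto
        moreover have "(\<lambda>j. min (lo n \<omega> j) (u j)) = lo n \<omega>" "(\<lambda>j. min (hi n \<omega> j) (u j)) = hi n \<omega>"
          using elim bounds(2)[of n \<omega>] by (auto simp: fun_eq_iff min_def intro: order_antisym order_trans)
        ultimately show ?case by (simp add: g_def ratio_def D)
      qed
    qed
    \<comment> \<open>Once the lower corner exceeds \<open>u\<close> in one coordinate, the
      truncated cell is degenerate there.\<close>
    have lim_B: "(\<lambda>n. g n \<omega>) \<longlonglongrightarrow> 0" if "\<omega> \<in> {0..<1} - ?B" for \<omega>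
    proof (rule tendsto_eventually)
      from that obtain j where "u j < U \<omega> j" by (auto simp: not_le)
      from order_tendstoD(1)[OF lo_U this]
      show "\<forall>\<^sub>F n in sequentially. g n \<omega> = 0"
      proof eventually_elim
        case (elim n)
        then have "min (lo n \<omega> j) (u j) = min (hi n \<omega> j) (u j)"
          using bounds(2)[of n \<omega> j] by simp
        then show ?case by (simp add: g_def ratio_def D cvol_degenerate[of _ j])
      qed
    qed
    have conv: "(\<lambda>n. \<integral>\<omega>. g n \<omega> * indicator S \<omega> \<partial>?\<Omega>) \<longlonglongrightarrow> l * measure ?\<Omega> S"
      if S [measurable]: "S \<in> sets ?\<Omega>" and l: "\<And>\<omega>. \<omega> \<in> S \<Longrightarrow> (\<lambda>n. g n \<omega>) \<longlonglongrightarrow> l" for S l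
    proof -
      have "(\<lambda>n. \<integral>\<omega>. g n \<omega> * indicator S \<omega> \<partial>?\<Omega>) \<longlonglongrightarrow> (\<integral>\<omega>. l * indicator S \<omega> \<partial>?\<Omega>)"
      proof (rule integral_dominated_convergence[where w = "\<lambda>_. 1"])
        show "AE \<omega> in ?\<Omega>. (\<lambda>n. g n \<omega> * indicator S \<omega>) \<longlonglongrightarrow> l * indicator S \<omega>"
          using l by (auto simp: indicator_def)
        show "AE \<omega> in ?\<Omega>. norm (g n \<omega> * indicator S \<omega>) \<le> 1" for n
          using g by (auto simp: indicator_def)
      qed auto
      moreover have "(\<integral>\<omega>. l * indicator S \<omega> \<partial>?\<Omega>) = l * measure ?\<Omega> S"
        using sets.sets_into_space[OF S] by (simp add: Int_absorb2)
      ultimately show ?thesis by (simp only:)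
    qed
    have "1 * measure ?\<Omega> ?A \<le> C (\<chi> j. u j)"
    proof (rule LIMSEQ_le_const2[OF conv[OF Am lim_A]], assumption, intro exI allI impI)
      fix n
      show "(\<integral>\<omega>. g n \<omega> * indicator ?A \<omega> \<partial>?\<Omega>) \<le> C (\<chi> j. u j)"
        unfolding int_g[of n, symmetric] using g
        by (intro integral_mono int_ind Am int) (auto simp: indicator_def)
    qed
    then show "measure P {x. \<forall>j. x $ j < u j \<or> u j = 1} \<le> C (\<chi> j. u j)"
      by (subst measure_P) auto
    have "(\<lambda>n. \<integral>\<omega>. g n \<omega> * indicator ({0..<1} - ?B) \<omega> \<partial>?\<Omega>) \<longlonglongrightarrow> 0 * measure ?\<Omega> ({0..<1} - ?B)"
      by (rule conv[OF Bc lim_B])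
    from tendsto_add[OF this tendsto_const[of "measure ?\<Omega> ?B"]]
    have "(\<lambda>n. (\<integral>\<omega>. g n \<omega> * indicator ({0..<1} - ?B) \<omega> \<partial>?\<Omega>) + measure ?\<Omega> ?B) \<longlonglongrightarrow> measure ?\<Omega> ?B"
      by simp
    then have "C (\<chi> j. u j) \<le> measure ?\<Omega> ?B"
    proof (rule LIMSEQ_le_const, intro exI allI impI)
      fix n
      have "C (\<chi> j. u j) \<le> (\<integral>\<omega>. g n \<omega> * indicator ({0..<1} - ?B) \<omega> + indicator ?B \<omega> \<partial>?\<Omega>)"
        unfolding int_g[of n, symmetric] using g
        by (intro integral_mono int Bochner_Integration.integrable_add int_ind Bc int_B)
          (auto simp: indicator_def space_restrict_space)
      also have "\<dots> = (\<integral>\<omega>. g n \<omega> * indicator ({0..<1} - ?B) \<omega> \<partial>?\<Omega>) + measure ?\<Omega> ?B"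
        using sets.sets_into_space[OF Bm]
        by (subst Bochner_Integration.integral_add[OF int_ind[OF Bc] int_B])
          (simp add: Int_absorb2)
      finally show "C (\<chi> j. u j) \<le> (\<integral>\<omega>. g n \<omega> * indicator ({0..<1} - ?B) \<omega> \<partial>?\<Omega>) + measure ?\<Omega> ?B" .
    qed
    then show "C (\<chi> j. u j) \<le> measure P {x. \<forall>j. x $ j \<le> u j}"
      by (subst measure_P) auto
  qed
  show ?thesis
    by (rule that[of P]) (use P sandwich in \<open>auto simp: P_def\<close>)
qed

text \<open>Off the hyperplanes \<open>x $ i = u i\<close> with \<open>u i < 1\<close>, the event of
  the lower bound is contained in that of the upper bound. These hyperplanes are null, so the two
  bounds meet.\<close>

lemma ex_measure_copula:
  fixes C :: "real ^ 'n \<Rightarrow> real"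
  assumes C: "copula C"
  obtains P :: "(real ^ 'n) measure" where "prob_space P" "sets P = sets borel"
    "\<And>u. (\<And>j. u j \<in> {0..1}) \<Longrightarrow> measure P {x. \<forall>j. x $ j \<le> u j} = C (\<chi> j. u j)"
proof (rule ex_measure_sandwich_copula[OF C])
  fix P :: "(real ^ 'n) measure"
  assume P: "prob_space P" and sP: "sets P = sets borel"
    and upper: "\<And>u. (\<And>j. u j \<in> {0..1}) \<Longrightarrow> measure P {x. \<forall>j. x $ j < u j \<or> u j = 1} \<le> C (\<chi> j. u j)"
    and lower: "\<And>u. (\<And>j. u j \<in> {0..1}) \<Longrightarrow> C (\<chi> j. u j) \<le> measure P {x. \<forall>j. x $ j \<le> u j}"
  interpret prob_space P by fact
  have nth [measurable]: "(\<lambda>x. x $ i) \<in> borel_measurable P" for i :: 'n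
    unfolding measurable_cong_sets[OF sP refl] by (rule measurable_vec_nth)
  have sp: "space P = UNIV" using sets_eq_imp_space_eq[OF sP] by simp
  have [measurable]: "{x. x $ i \<le> t} \<in> events" "{x. x $ i < t} \<in> events" "{x. x $ i = t} \<in> events" for i t
  proof -
    have "{x \<in> space P. x $ i \<le> t} \<in> events" "{x \<in> space P. x $ i < t} \<in> events"
      "{x \<in> space P. x $ i = t} \<in> events" by measurable
    then show "{x. x $ i \<le> t} \<in> events" "{x. x $ i < t} \<in> events" "{x. x $ i = t} \<in> events"
      by (simp_all add: sp)
  qed
  \<comment> \<open>The value 1 in all other coordinates makes their constraints void, and the
    margin clause evaluates \<open>C\<close>.\<close>
  have less: "prob {x. x $ i < t} \<le> t" if "0 \<le> t" "t < 1" for i t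
  proof -
    have "prob {x. \<forall>j. x $ j < (if j = i then t else 1) \<or> (if j = i then t else 1) = 1} \<le> t"
      using upper[of "\<lambda>j. if j = i then t else 1"] copula_margin[OF C, of t i] that by auto
    also have "{x. \<forall>j. x $ j < (if j = i then t else 1) \<or> (if j = i then t else 1) = 1} = {x :: real ^ 'n. x $ i < t}"
      using that by auto
    finally show ?thesis .
  qed
  have le: "t \<le> prob {x. x $ i \<le> t}" if "t \<in> {0..1}" for i t
  proof -
    have "t \<le> prob {x. \<forall>j. x $ j \<le> (if j = i then t else 1)}"
      using lower[of "\<lambda>j. if j = i then t else 1"] copula_margin[OF C, of t i] that by auto
    also have "\<dots> \<le> prob {x. x $ i \<le> t}"
      by (rule finite_measure_mono) (auto dest: spec[of _ i])
    finally show ?thesis .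
  qed
  have null: "prob {x. x $ i = t} = 0" if t: "0 \<le> t" "t < 1" for i t
  proof (rule ccontr)
    let ?m = "prob {x. x $ i = t}"
    assume "?m \<noteq> 0"
    then have m: "0 < ?m" by (simp add: zero_less_measure_iff)
    \<comment> \<open>Mass \<open>?m\<close> at \<open>t\<close> would give
      \<open>?m + (t - e) \<le> t + e\<close>, contradicting \<open>e \<le> ?m / 3\<close>. The
      other bound keeps \<open>t + e\<close> below 1, where \<open>less\<close> applies.\<close>
    define e where "e = min (?m / 3) ((1 - t) / 2)"
    have e: "0 < e" "t + e < 1" "3 * e \<le> ?m" using m t by (auto simp: e_def min_def field_simps)
    have "?m + prob {x. x $ i \<le> t - e} = prob ({x. x $ i = t} \<union> {x. x $ i \<le> t - e})"
      using e(1) by (intro finite_measure_Union[symmetric]) auto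
    also have "\<dots> \<le> prob {x. x $ i < t + e}"
      using e(1) by (intro finite_measure_mono) auto
    also have "\<dots> \<le> t + e" using less[of "t + e"] t e by simp
    finally have "?m + prob {x. x $ i \<le> t - e} \<le> t + e" .
    moreover have "t - e \<le> prob {x. x $ i \<le> t - e}"
    proof (cases "0 \<le> t - e")
      case True then show ?thesis using le[of "t - e"] t e by simp
    next
      case False then show ?thesis using measure_nonneg[of P "{x. x $ i \<le> t - e}"] by linarith
    qed
    ultimately show False using e by linarith
  qed
  have "measure P {x. \<forall>j. x $ j \<le> u j} = C (\<chi> j. u j)" if u: "\<And>j. u j \<in> {0..1}" for u
  proof (rule antisym[OF _ lower[OF u]])
    have "AE x in P. \<forall>j. x $ j \<noteq> u j \<or> u j = 1"
    proof (subst AE_all_countable, rule allI)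
      fix j
      show "AE x in P. x $ j \<noteq> u j \<or> u j = 1"
      proof (cases "u j = 1")
        case False
        then have "prob {x. x $ j = u j} = 0" using u[of j] by (intro null) auto
        then show ?thesis
          by (intro AE_I[where N = "{x. x $ j = u j}"]) (auto simp: emeasure_eq_measure)
      qed simp
    qed
    then have "prob {x. \<forall>j. x $ j \<le> u j} \<le> prob {x. \<forall>j. x $ j < u j \<or> u j = 1}"
    proof (intro finite_measure_mono_AE)
      assume "AE x in P. \<forall>j. x $ j \<noteq> u j \<or> u j = 1"
      then show "AE x in P. x \<in> {x. \<forall>j. x $ j \<le> u j} \<longrightarrow> x \<in> {x. \<forall>j. x $ j < u j \<or> u j = 1}"
        by eventually_elim (auto simp: order_le_less)
      have "{x \<in> space P. \<forall>j. x $ j < u j \<or> u j = 1} \<in> events" by measurable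
      then show "{x. \<forall>j. x $ j < u j \<or> u j = 1} \<in> events" by (simp add: sp)
    qed
    also have "\<dots> \<le> C (\<chi> j. u j)" by (rule upper[OF u])
    finally show "prob {x. \<forall>j. x $ j \<le> u j} \<le> C (\<chi> j. u j)" .
  qed
  with P sP show ?thesis by (rule that)
qed

section \<open>Uniform margins and uniqueness of laws\<close>

text \<open>The end points are left out since quantiles may be infinite there.\<close>

abbreviation unit_lborel :: "real measure" where
  "unit_lborel \<equiv> restrict_space lborel {0<..<1}"

lemma prob_space_unit_lborel: "prob_space unit_lborel"
  by (auto simp: space_restrict_space emeasure_restrict_space intro!: prob_spaceI)

lemma measure_unit_lborel_atMost:
  assumes "t \<in> {0..1}"
  shows "measure unit_lborel {u \<in> {0<..<1}. u \<le> t} = t"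
proof -
  have "measure unit_lborel {u \<in> {0<..<1}. u \<le> t} = measure lborel {u \<in> {0<..<1}. u \<le> t}"
    by (rule measure_restrict_space) auto
  moreover have "{u \<in> {0<..<1}. u \<le> t} = (if t < 1 then {0<..t} else {0<..<1})"
    using assms by auto
  ultimately show ?thesis using assms by simp
qed

text \<open>Lower orthants generate the Borel sets, are closed under intersection (the corners
  combine by \<open>inf\<close>), and exhaust the space along the diagonal.\<close>

lemma measure_eqI_atMost:
  fixes M N :: "'a :: ordered_euclidean_space measure"
  assumes "prob_space M" "prob_space N" "sets M = sets borel" "sets N = sets borel"
    and eq: "\<And>a. measure M {..a} = measure N {..a}"
  shows "M = N"
proof (rule measure_eqI_generator_eq[where E = "range atMost" and \<Omega> = UNIV and A = "\<lambda>n::nat. {..(\<Sum>b\<in>Basis. real n *\<^sub>R b)}"])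
  interpret M: prob_space M by fact
  interpret N: prob_space N by fact
  show "Int_stable (range (atMost :: 'a \<Rightarrow> _))"
  proof (unfold Int_stable_def, safe)
    fix a b :: 'a
    have "{..a} \<inter> {..b} = {..inf a b}" by auto
    then show "{..a} \<inter> {..b} \<in> range atMost" by simp
  qed
  show "emeasure M X = emeasure N X" if "X \<in> range atMost" for X
    using that eq by (auto simp: M.emeasure_eq_measure N.emeasure_eq_measure)
  show "sets M = sigma_sets UNIV (range atMost)" "sets N = sigma_sets UNIV (range atMost)"
    using assms(3,4) by (simp_all add: borel_eq_atMost)
  show "(\<Union>n::nat. {..(\<Sum>b\<in>Basis. real n *\<^sub>R b) :: 'a}) = UNIV"
  proof -
    have "\<exists>n::nat. x \<le> (\<Sum>b\<in>Basis. real n *\<^sub>R b)" for x :: 'a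
    proof -
      obtain n where "norm x \<le> real n" using real_arch_simple by blast
      then have "x \<bullet> i \<le> real n" if "i \<in> Basis" for i
        using Basis_le_norm[OF that, of x] by linarith
      then show ?thesis by (auto simp: eucl_le[where 'a = 'a])
    qed
    then show ?thesis by auto
  qed
  show "emeasure M {..(\<Sum>b\<in>Basis. real n *\<^sub>R b)} \<noteq> \<infinity>" for n by simp
qed auto

text \<open>As \<open>C\<close> is 1 at the upper corner of the cube, almost surely no coordinate
  exceeds 1. Constraints with bound 1 can thus be dropped, and the margin clause gives the uniform
  distribution function on [0, 1]; monotonicity fixes it elsewhere.\<close>

lemma distr_nth_copula_measure:
  fixes P :: "(real ^ 'n) measure"
  assumes C: "copula C" and P: "prob_space P" "sets P = sets borel"
    "\<And>u. (\<And>j. u j \<in> {0..1}) \<Longrightarrow> measure P {x. \<forall>j. x $ j \<le> u j} = C (\<chi> j. u j)"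
  shows "distr P borel (\<lambda>x. x $ i) = distr unit_lborel borel (\<lambda>u. u)"
proof -
  interpret prob_space P by fact
  interpret U: prob_space unit_lborel by (rule prob_space_unit_lborel)
  have nth [measurable]: "(\<lambda>x. x $ i) \<in> borel_measurable P" for i :: 'n
    unfolding measurable_cong_sets[OF P(2) refl] by (rule measurable_vec_nth)
  have sp: "space P = UNIV" using sets_eq_imp_space_eq[OF P(2)] by simp
  have id: "(\<lambda>u :: real. u) \<in> borel_measurable unit_lborel"
    by (intro measurable_restrict_space1) simp
  have cube: "measure P {x. \<forall>j. x $ j \<le> 1} = 1"
    using P(3)[of "\<lambda>_. 1"] copula_margin[OF C, of 1 undefined] by simp
  have "{x \<in> space P. \<forall>j. x $ j \<le> 1} \<in> events" by measurable
  then have cube_ae: "AE x in P. \<forall>j. x $ j \<le> 1"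
    using cube AE_in_set_eq_1[of "{x. \<forall>j. x $ j \<le> 1}"] by (simp add: sp)
  have ev: "{x. x $ i \<le> t} \<in> events" for t
  proof -
    have "{x \<in> space P. x $ i \<le> t} \<in> events" by measurable
    then show ?thesis by (simp add: sp)
  qed
  have P_le: "measure P {x. x $ i \<le> t} = t" if t: "t \<in> {0..1}" for t
  proof -
    have "{x \<in> space P. \<forall>j. x $ j \<le> (if j = i then t else 1)} \<in> events" by measurable
    moreover have "AE x in P. x \<in> {x. x $ i \<le> t} \<longleftrightarrow> x \<in> {x. \<forall>j. x $ j \<le> (if j = i then t else 1)}"
      using cube_ae by eventually_elim auto
    ultimately have "measure P {x. x $ i \<le> t} = measure P {x. \<forall>j. x $ j \<le> (if j = i then t else 1)}"
      by (intro finite_measure_eq_AE ev) (auto simp: sp)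
    also have "\<dots> = t"
      using P(3)[of "\<lambda>j. if j = i then t else 1"] copula_margin[OF C t, of i] t by auto
    finally show ?thesis .
  qed
  have P_cdf: "measure P {x. x $ i \<le> t} = max 0 (min 1 t)" for t
  proof -
    consider "t \<in> {0..1}" | "t < 0" | "1 < t" by fastforce
    then show ?thesis
    proof cases
      case 1 then show ?thesis using P_le by auto
    next
      case 2
      then have "measure P {x. x $ i \<le> t} \<le> measure P {x. x $ i \<le> 0}"
        by (intro finite_measure_mono ev) auto
      then show ?thesis using P_le[of 0] 2 measure_nonneg[of P "{x. x $ i \<le> t}"] by simp
    next
      case 3
      then have "measure P {x. x $ i \<le> 1} \<le> measure P {x. x $ i \<le> t}"
        by (intro finite_measure_mono ev) auto
      then show ?thesis using P_le[of 1] 3 prob_le_1[of "{x. x $ i \<le> t}"] by simp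
    qed
  qed
  have U_cdf: "measure unit_lborel {u \<in> {0<..<1}. u \<le> t} = max 0 (min 1 t)" for t
  proof -
    have "{u \<in> {0<..<1}. u \<le> t} = {u \<in> {0<..<1}. u \<le> max 0 (min 1 t)}"
      by auto
    then show ?thesis using measure_unit_lborel_atMost[of "max 0 (min 1 t)"] by simp
  qed
  show ?thesis
  proof (rule measure_eqI_atMost)
    show "measure (distr P borel (\<lambda>x. x $ i)) {..t} = measure (distr unit_lborel borel (\<lambda>u. u)) {..t}" for t
    proof -
      have "measure (distr P borel (\<lambda>x. x $ i)) {..t} = measure P {x. x $ i \<le> t}"
        by (subst measure_distr[OF nth]) (auto simp: sp intro!: arg_cong[where f = "measure P"])
      also have "\<dots> = measure unit_lborel {u \<in> {0<..<1}. u \<le> t}"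
        unfolding P_cdf U_cdf ..
      also have "\<dots> = measure (distr unit_lborel borel (\<lambda>u. u)) {..t}"
        by (subst measure_distr[OF id]) (auto simp: space_restrict_space intro!: arg_cong[where f = "measure unit_lborel"])
      finally show ?thesis .
    qed
  qed (simp_all add: prob_space_distr[OF nth] U.prob_space_distr[OF id])
qed

section \<open>Optimality of the comonotone coupling on the line\<close>

lemma measurable_fst_snd_borel:
  fixes Q :: "('a :: second_countable_topology \<times> 'b :: second_countable_topology) measure"
  assumes "sets Q = sets borel"
  shows "fst \<in> borel_measurable Q" "snd \<in> borel_measurable Q"
  unfolding measurable_cong_sets[OF assms refl]
  by (auto intro: borel_measurable_continuous_onI continuous_on_fst continuous_on_snd continuous_on_id
      simp flip: borel_prod)

text \<open>A hinge of the difference is an integral of indicators of quadrants, whose masses are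
  controlled by the joint distribution function and the margins.\<close>

lemma nn_integral_hinge:
  fixes Q :: "(real \<times> real) measure"
  assumes "sigma_finite_measure Q" "sets Q = sets borel"
  shows "(\<integral>\<^sup>+w. ennreal (max 0 (fst w - snd w - z)) \<partial>Q)
    = (\<integral>\<^sup>+s. emeasure Q {w. snd w + z \<le> s \<and> s < fst w} \<partial>lborel)"
proof -
  interpret Q: sigma_finite_measure Q by fact
  interpret pair_sigma_finite Q lborel ..
  note [measurable_cong] = assms(2)
  have sp: "space Q = UNIV" using sets_eq_imp_space_eq[OF assms(2)] by simp
  let ?h = "\<lambda>w s. indicator {w. snd w + z \<le> s \<and> s < fst w} w :: ennreal"
  note [measurable] = measurable_fst_snd_borel[OF assms(2)]
  have m: "{w \<in> space Q. snd w + z \<le> s \<and> s < fst w} \<in> sets Q" for s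
    by measurable
  have "(\<integral>\<^sup>+w. ennreal (max 0 (fst w - snd w - z)) \<partial>Q) = (\<integral>\<^sup>+w. (\<integral>\<^sup>+s. ?h w s \<partial>lborel) \<partial>Q)"
  proof (rule nn_integral_cong)
    fix w :: "real \<times> real"
    have "(\<integral>\<^sup>+s. ?h w s \<partial>lborel) = (\<integral>\<^sup>+s. indicator {snd w + z..<fst w} s \<partial>lborel)"
      by (intro nn_integral_cong) (auto simp: indicator_def)
    also have "\<dots> = ennreal (max 0 (fst w - snd w - z))"
      by (cases "snd w + z \<le> fst w") (auto simp: max_def algebra_simps)
    finally show "ennreal (max 0 (fst w - snd w - z)) = (\<integral>\<^sup>+s. ?h w s \<partial>lborel)" ..
  qed
  also have "\<dots> = (\<integral>\<^sup>+s. (\<integral>\<^sup>+w. ?h w s \<partial>Q) \<partial>lborel)"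
  proof (rule Fubini'[symmetric])
    have "Measurable.pred (Q \<Otimes>\<^sub>M lborel) (\<lambda>(w, s). snd w + z \<le> s \<and> s < fst w)"
      by measurable
    then show "(\<lambda>(w, s). ?h w s) \<in> borel_measurable (Q \<Otimes>\<^sub>M lborel)"
      by (auto intro!: borel_measurable_indicator' simp: split_beta' pred_def)
  qed
  also have "\<dots> = (\<integral>\<^sup>+s. emeasure Q {w. snd w + z \<le> s \<and> s < fst w} \<partial>lborel)"
    using m sp by (intro nn_integral_cong nn_integral_indicator) simp
  finally show ?thesis .
qed

text \<open>Taylor's formula at 0 with integral remainder, applied to \<open>r powr p\<close> for
  \<open>r = \<bar>t\<bar>\<close>. For \<open>z \<ge> 0\<close> at most one of the two hinges is
  nonzero, and their sum is \<open>max 0 (r - z)\<close>.\<close>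

lemma powr_eq_nn_integral_hinge:
  fixes p t :: real
  assumes "1 < p"
  shows "ennreal (\<bar>t\<bar> powr p) = (\<integral>\<^sup>+z. ennreal (p * (p - 1) * z powr (p - 2)) *
    (ennreal (max 0 (t - z)) + ennreal (max 0 (- t - z))) * indicator {0..} z \<partial>lborel)"
proof -
  define r where "r = \<bar>t\<bar>"
  have r: "0 \<le> r" by (simp add: r_def)
  \<comment> \<open>An antiderivative of \<open>?g\<close>, continuous at 0 because
    \<open>p > 1\<close>. The derivative is taken only in the interior, since
    \<open>z powr (p - 2)\<close> is singular at 0 for \<open>p < 2\<close>.\<close>
  let ?G = "\<lambda>z. p * r * z powr (p - 1) - (p - 1) * z powr p"
  let ?g = "\<lambda>z. p * (p - 1) * z powr (p - 2) * (r - z)"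
  have "(?g has_integral (?G r - ?G 0)) {0..r}"
  proof (rule fundamental_theorem_of_calculus_interior[OF r])
    show "continuous_on {0..r} ?G"
      using assms by (intro continuous_intros continuous_on_powr') auto
    fix z assume z: "z \<in> {0<..<r}"
    then have "z powr (p - 1) = z powr (p - 2) * z"
      by (simp add: powr_mult_base[symmetric] mult.commute) (simp add: powr_mult_base)
    then have "(?G has_real_derivative ?g z) (at z)"
      using z by (auto intro!: derivative_eq_intros simp: algebra_simps)
    then show "(?G has_vector_derivative ?g z) (at z)"
      by (simp add: has_real_derivative_iff_has_vector_derivative)
  qed
  moreover have "?G r - ?G 0 = r powr p"
  proof (cases "r = 0")
    case False
    with r have "r * r powr (p - 1) = r powr p"
      by (simp add: powr_mult_base)
    then show ?thesis using assms by (simp add: algebra_simps)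
  qed simp
  ultimately have "(?g has_integral r powr p) {0..r}" by simp
  then have "(\<integral>\<^sup>+z. ennreal (?g z) * indicator {0..r} z \<partial>lborel) = ennreal (r powr p)"
    using assms by (intro nn_integral_has_integral_lebesgue') auto
  moreover have "ennreal (?g z) * indicator {0..r} z = ennreal (p * (p - 1) * z powr (p - 2)) *
    (ennreal (max 0 (t - z)) + ennreal (max 0 (- t - z))) * indicator {0..} z" for z
  proof (cases "0 \<le> z")
    case z: True
    have "ennreal (max 0 (t - z)) + ennreal (max 0 (- t - z)) = ennreal (max 0 (r - z))"
      using z by (auto simp: r_def max_def abs_if simp flip: ennreal_plus)
    moreover have "ennreal (?g z) * indicator {0..r} z = ennreal (p * (p - 1) * z powr (p - 2)) * ennreal (max 0 (r - z))"
      using z assms by (auto simp: indicator_def max_def ennreal_mult')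
    ultimately show ?thesis using z by simp
  qed simp
  ultimately show ?thesis by (simp add: r_def)
qed

text \<open>A quadrant is a half-plane minus a lower orthant; for fixed margins a larger joint
  distribution function therefore means smaller quadrant masses.\<close>

lemma prob_fst_snd_halfspaces:
  fixes M :: "(real \<times> real) measure"
  assumes "prob_space M" "sets M = sets borel"
  shows "measure M {w. snd w \<le> a \<and> b < fst w} = measure M {w. snd w \<le> a} - measure M ({..b} \<times> {..a})"
    "measure M {w. fst w \<le> a \<and> b < snd w} = measure M {w. fst w \<le> a} - measure M ({..a} \<times> {..b})"
proof -
  interpret prob_space M by fact
  have [simp]: "{w :: real \<times> real. snd w \<le> a} \<in> sets M" "{w :: real \<times> real. fst w \<le> a} \<in> sets M"
    "{..a} \<times> {..b} \<in> sets M" "{..b} \<times> {..a} \<in> sets M"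
    unfolding assms(2) by (auto intro!: borel_closed closed_Collect_le continuous_intros closed_Times)
  have eq: "{w. snd w \<le> a \<and> b < fst w} = {w. snd w \<le> a} - {..b} \<times> {..a}"
    "{w. fst w \<le> a \<and> b < snd w} = {w. fst w \<le> a} - {..a} \<times> {..b}"
    by auto
  show "measure M {w. snd w \<le> a \<and> b < fst w} = measure M {w. snd w \<le> a} - measure M ({..b} \<times> {..a})"
    unfolding eq(1) by (rule finite_measure_Diff) auto
  show "measure M {w. fst w \<le> a \<and> b < snd w} = measure M {w. fst w \<le> a} - measure M ({..a} \<times> {..b})"
    unfolding eq(2) by (rule finite_measure_Diff) auto
qed

text \<open>The analogue of \<open>couplings\<close> for measures on the line, to which the
  coordinate pairs of a coupling belong.\<close>

definition plane_coupling :: "real measure \<Rightarrow> real measure \<Rightarrow> (real \<times> real) measure \<Rightarrow> bool" where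
  "plane_coupling A B Q \<longleftrightarrow> prob_space Q \<and> sets Q = sets borel \<and> distr Q borel fst = A \<and> distr Q borel snd = B"

lemma plane_coupling_margins:
  assumes "plane_coupling A B Q"
  shows "measure Q {w. fst w \<le> x} = cdf A x" "measure Q {w. snd w \<le> x} = cdf B x"
proof -
  have s: "sets Q = sets borel" and A: "A = distr Q borel fst" and B: "B = distr Q borel snd"
    using assms by (auto simp: plane_coupling_def)
  have sp: "space Q = UNIV" using sets_eq_imp_space_eq[OF s] by simp
  show "measure Q {w. fst w \<le> x} = cdf A x"
    unfolding A cdf_def by (subst measure_distr[OF measurable_fst_snd_borel(1)[OF s]])
      (auto simp: sp intro!: arg_cong[where f = "measure Q"])
  show "measure Q {w. snd w \<le> x} = cdf B x"
    unfolding B cdf_def by (subst measure_distr[OF measurable_fst_snd_borel(2)[OF s]])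
      (auto simp: sp intro!: arg_cong[where f = "measure Q"])
qed

text \<open>The orthant lies in two half-planes whose masses are fixed by the margins.\<close>

lemma plane_coupling_frechet:
  assumes "plane_coupling A B Q"
  shows "measure Q ({..x} \<times> {..y}) \<le> min (cdf A x) (cdf B y)"
proof -
  interpret prob_space Q using assms by (simp add: plane_coupling_def)
  have "{w :: real \<times> real. fst w \<le> x} \<in> events" "{w :: real \<times> real. snd w \<le> y} \<in> events"
    using assms by (auto simp: plane_coupling_def intro!: borel_closed closed_Collect_le continuous_intros)
  then show ?thesis
    unfolding plane_coupling_margins[OF assms, symmetric]
    by (auto intro!: finite_measure_mono)
qed

text \<open>\<open>Q\<close> attains the Frechet bound, so with equal margins its quadrant masses
  are least. Integrating over quadrants compares the hinges, and integrating over hinges compares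
  the costs.\<close>

lemma comonotone_coupling_optimal:
  fixes Q R :: "(real \<times> real) measure"
  assumes p: "1 \<le> p" and Q: "plane_coupling A B Q" and R: "plane_coupling A B R"
    and Q_cdf: "\<And>x y. measure Q ({..x} \<times> {..y}) = min (cdf A x) (cdf B y)"
  shows "(\<integral>\<^sup>+(x, y). ennreal (\<bar>x - y\<bar> powr p) \<partial>Q) \<le> (\<integral>\<^sup>+(x, y). ennreal (\<bar>x - y\<bar> powr p) \<partial>R)"
proof -
  have sQ: "sets Q = sets borel" and sR: "sets R = sets borel"
    using Q R by (auto simp: plane_coupling_def)
  interpret Q: prob_space Q using Q by (simp add: plane_coupling_def)
  interpret R: prob_space R using R by (simp add: plane_coupling_def)
  define k where "k z = (\<lambda>w :: real \<times> real. ennreal (max 0 (fst w - snd w - z)) + ennreal (max 0 (- (fst w - snd w) - z)))" for z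
  \<comment> \<open>Exchanging the coordinates reduces the hinge of the opposite difference to
    \<open>nn_integral_hinge\<close>.\<close>
  define swap where "swap = (\<lambda>w :: real \<times> real. (snd w, fst w))"
  have ordered: "measure R ({..x} \<times> {..y}) \<le> measure Q ({..x} \<times> {..y})" for x y
    using plane_coupling_frechet[OF R] Q_cdf by simp
  have swap_m: "swap \<in> measurable S borel" if "sets S = sets borel" for S
    unfolding measurable_cong_sets[OF that refl] swap_def
    by (intro borel_measurable_continuous_onI continuous_intros)
  have hinge: "(\<integral>\<^sup>+w. k z w \<partial>S) = (\<integral>\<^sup>+s. emeasure S {w. snd w + z \<le> s \<and> s < fst w} \<partial>lborel)
      + (\<integral>\<^sup>+s. emeasure S {w. fst w + z \<le> s \<and> s < snd w} \<partial>lborel)"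
    if S: "prob_space S" "sets S = sets borel" for S z
  proof -
    interpret S: prob_space S by fact
    interpret S': prob_space "distr S borel swap"
      by (rule S.prob_space_distr[OF swap_m[OF S(2)]])
    have sp: "space S = UNIV" using sets_eq_imp_space_eq[OF S(2)] by simp
    note [measurable] = measurable_fst_snd_borel[OF S(2)]
    have swap_emeasure: "emeasure (distr S borel swap) {w. snd w + z \<le> s \<and> s < fst w}
        = emeasure S {w. fst w + z \<le> s \<and> s < snd w}" for s
    proof -
      have "{w :: real \<times> real. snd w + z \<le> s \<and> s < fst w} = {w. snd w + z \<le> s} \<inter> {w. s < fst w}"
        by auto
      also have "\<dots> \<in> sets borel"
        by (intro sets.Int borel_closed borel_open closed_Collect_le open_Collect_less continuous_intros)
      finally show ?thesis
        by (subst emeasure_distr[OF swap_m[OF S(2)]])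
          (auto simp: sp swap_def intro!: arg_cong[where f = "emeasure S"])
    qed
    have "(\<integral>\<^sup>+w. k z w \<partial>S) = (\<integral>\<^sup>+w. ennreal (max 0 (fst w - snd w - z)) \<partial>S)
        + (\<integral>\<^sup>+w. ennreal (max 0 (snd w - fst w - z)) \<partial>S)"
      unfolding k_def by (subst nn_integral_add) (auto simp: algebra_simps)
    also have "(\<integral>\<^sup>+w. ennreal (max 0 (snd w - fst w - z)) \<partial>S)
        = (\<integral>\<^sup>+w. ennreal (max 0 (fst w - snd w - z)) \<partial>distr S borel swap)"
      using measurable_fst_snd_borel[of "borel :: (real \<times> real) measure"]
      by (subst nn_integral_distr[OF swap_m[OF S(2)]]) (auto simp: swap_def)
    also have "\<dots> = (\<integral>\<^sup>+s. emeasure S {w. fst w + z \<le> s \<and> s < snd w} \<partial>lborel)"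
      unfolding swap_emeasure[symmetric] by (rule nn_integral_hinge) (auto intro: S'.sigma_finite_measure_axioms)
    also have "(\<integral>\<^sup>+w. ennreal (max 0 (fst w - snd w - z)) \<partial>S)
        = (\<integral>\<^sup>+s. emeasure S {w. snd w + z \<le> s \<and> s < fst w} \<partial>lborel)"
      by (rule nn_integral_hinge) (use S in \<open>auto intro: S.sigma_finite_measure_axioms\<close>)
    finally show ?thesis .
  qed
  have kernel: "(\<integral>\<^sup>+w. k z w \<partial>Q) \<le> (\<integral>\<^sup>+w. k z w \<partial>R)" for z
  proof -
    \<comment> \<open>Reading \<open>snd w + z \<le> s\<close> as \<open>snd w \<le> s - z\<close>
      gives the quadrants of \<open>prob_fst_snd_halfspaces\<close>; the marginal terms agree for
      \<open>Q\<close> and \<open>R\<close>, leaving the joint ones.\<close>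
    have "emeasure Q {w. snd w + z \<le> s \<and> s < fst w} \<le> emeasure R {w. snd w + z \<le> s \<and> s < fst w}"
      "emeasure Q {w. fst w + z \<le> s \<and> s < snd w} \<le> emeasure R {w. fst w + z \<le> s \<and> s < snd w}" for s
      unfolding Q.emeasure_eq_measure R.emeasure_eq_measure le_diff_eq[symmetric]
        prob_fst_snd_halfspaces[OF Q.prob_space_axioms sQ] prob_fst_snd_halfspaces[OF R.prob_space_axioms sR]
        plane_coupling_margins[OF Q] plane_coupling_margins[OF R]
      using ordered by (auto intro!: ennreal_leI)
    then show ?thesis
      unfolding hinge[OF Q.prob_space_axioms sQ] hinge[OF R.prob_space_axioms sR]
      by (intro add_mono nn_integral_mono) auto
  qed
  show ?thesis
  proof (cases "p = 1")
    case True
    \<comment> \<open>The weight \<open>p * (p - 1)\<close> of the mixture vanishes at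
      \<open>p = 1\<close>, but there the cost is itself the sum of the two hinges at 0.\<close>
    have linear: "ennreal (\<bar>fst w - snd w\<bar> powr p) = k 0 w" for w
      by (auto simp: True k_def max_def abs_if)
    show ?thesis unfolding split_beta' linear by (rule kernel)
  next
    case False
    with p have p: "1 < p" by simp
    \<comment> \<open>Fubini moves the weight outside the integral over \<open>S\<close>, so that
      only hinge integrals remain to be compared.\<close>
    have mixture: "(\<integral>\<^sup>+w. ennreal (\<bar>fst w - snd w\<bar> powr p) \<partial>S) =
        (\<integral>\<^sup>+z. ennreal (p * (p - 1) * z powr (p - 2)) * indicator {0..} z * (\<integral>\<^sup>+w. k z w \<partial>S) \<partial>lborel)"
      if S: "prob_space S" "sets S = sets borel" for S
    proof -
      interpret S: prob_space S by fact
      interpret pair_sigma_finite S lborel ..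
      note [measurable] = measurable_fst_snd_borel[OF S(2)]
      have "(\<integral>\<^sup>+w. ennreal (\<bar>fst w - snd w\<bar> powr p) \<partial>S) =
          (\<integral>\<^sup>+w. (\<integral>\<^sup>+z. ennreal (p * (p - 1) * z powr (p - 2)) * indicator {0..} z * k z w \<partial>lborel) \<partial>S)"
        by (subst powr_eq_nn_integral_hinge[OF p]) (simp add: k_def mult_ac)
      also have "\<dots> = (\<integral>\<^sup>+z. (\<integral>\<^sup>+w. ennreal (p * (p - 1) * z powr (p - 2)) * indicator {0..} z * k z w \<partial>S) \<partial>lborel)"
        unfolding k_def by (rule Fubini'[symmetric]) measurable
      also have "\<dots> = (\<integral>\<^sup>+z. ennreal (p * (p - 1) * z powr (p - 2)) * indicator {0..} z * (\<integral>\<^sup>+w. k z w \<partial>S) \<partial>lborel)"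
        unfolding k_def by (intro nn_integral_cong nn_integral_cmult) measurable
      finally show ?thesis .
    qed
    show ?thesis
      unfolding split_beta' mixture[OF Q.prob_space_axioms sQ] mixture[OF R.prob_space_axioms sR]
      by (rule nn_integral_mono, rule mult_left_mono[OF kernel zero_le])
  qed
qed

section \<open>Quantile transforms\<close>

abbreviation real_quantile :: "(real \<Rightarrow> real) \<Rightarrow> real \<Rightarrow> real" where
  "real_quantile F u \<equiv> real_of_ereal (quantile F u)"

text \<open>The set defining \<open>quantile F u\<close> shrinks as \<open>u\<close> grows, so
  \<open>quantile F\<close> is monotone for every \<open>F\<close> and its sublevel sets are
  intervals.\<close>

lemma measurable_real_quantile [measurable]: "real_quantile F \<in> borel_measurable borel"
proof -
  have "quantile F \<in> borel_measurable borel"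
  proof (rule borel_measurableI_le)
    fix y
    have mono: "quantile F u \<le> quantile F v" if "u \<le> v" for u v
      unfolding quantile_def using that by (intro INF_superset_mono) auto
    have "is_interval {u. quantile F u \<le> y}"
      unfolding is_interval_1 using mono by (auto intro: order_trans)
    then show "{u \<in> space borel. quantile F u \<le> y} \<in> sets borel"
      by (simp add: real_interval_borel_measurable)
  qed
  then show ?thesis by measurable
qed

text \<open>Right-continuity makes the infimum attained. This Galois connection turns events about
  quantiles into events about the uniform parameter.\<close>

lemma real_quantile_le_iff:
  assumes "real_distribution M" "u \<in> {0<..<1}"
  shows "real_quantile (cdf M) u \<le> x \<longleftrightarrow> u \<le> cdf M x"
proof -
  interpret cdf_distribution M using assms(1) by (simp add: cdf_distribution_def)
  \<comment> \<open>\<open>I\<close> is the generalised inverse supplied by the locale. Its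
    equivalence identifies the extended real quantile with \<open>ereal q\<close>, which is
    finite.\<close>
  define q where "q = I u"
  have q: "u \<le> cdf M x \<longleftrightarrow> q \<le> x" for x
    unfolding q_def using pseudoinverse' assms(2) by blast
  then have "quantile (cdf M) u = ereal q"
    unfolding quantile_def by (intro antisym INF_lower INF_greatest) simp_all
  with q show ?thesis by simp
qed

definition comonotone_coupling :: "real measure \<Rightarrow> real measure \<Rightarrow> (real \<times> real) measure" where
  "comonotone_coupling A B =
    distr unit_lborel borel (\<lambda>u. (real_quantile (cdf A) u, real_quantile (cdf B) u))"

lemma measurable_quantile_pair:
  "(\<lambda>u. (real_quantile F u, real_quantile G u)) \<in> borel_measurable unit_lborel"
proof -
  have "(\<lambda>u. (real_quantile F u, real_quantile G u)) \<in> measurable borel (borel \<Otimes>\<^sub>M borel)"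
    by measurable
  then show ?thesis by (intro measurable_restrict_space1) (simp add: borel_prod)
qed

text \<open>Both quantiles obey their bounds exactly when the shared parameter is at most both
  distribution function values.\<close>

lemma comonotone_coupling_cdf:
  assumes A: "real_distribution A" and B: "real_distribution B"
  shows "measure (comonotone_coupling A B) ({..x} \<times> {..y}) = min (cdf A x) (cdf B y)"
proof -
  interpret A: real_distribution A by fact
  interpret B: real_distribution B by fact
  have "measure (comonotone_coupling A B) ({..x} \<times> {..y}) =
      measure unit_lborel {u \<in> {0<..<1}. u \<le> min (cdf A x) (cdf B y)}"
    unfolding comonotone_coupling_def
    by (subst measure_distr[OF measurable_quantile_pair])
      (auto simp: space_restrict_space real_quantile_le_iff[OF A] real_quantile_le_iff[OF B]
        closed_Times intro!: arg_cong[where f = "measure unit_lborel"])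
  also have "\<dots> = min (cdf A x) (cdf B y)"
    using A.cdf_nonneg B.cdf_nonneg A.cdf_bounded_prob B.cdf_bounded_prob
    by (intro measure_unit_lborel_atMost) (auto simp: min_le_iff_disj)
  finally show ?thesis .
qed

text \<open>Inverse transform sampling, by \<open>real_quantile_le_iff\<close>.\<close>

lemma distr_real_quantile:
  assumes A: "real_distribution A"
  shows "distr unit_lborel borel (real_quantile (cdf A)) = A"
proof (rule measure_eqI_atMost)
  interpret A: real_distribution A by fact
  have q: "real_quantile (cdf A) \<in> borel_measurable unit_lborel"
    by (intro measurable_restrict_space1) measurable
  show "prob_space A" "sets A = sets borel" by (simp_all add: A.prob_space_axioms)
  show "prob_space (distr unit_lborel borel (real_quantile (cdf A)))"
    by (rule prob_space.prob_space_distr[OF prob_space_unit_lborel q])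
  fix x
  have "measure (distr unit_lborel borel (real_quantile (cdf A))) {..x} =
      measure unit_lborel {u \<in> {0<..<1}. u \<le> cdf A x}"
    by (subst measure_distr[OF q])
      (auto simp: space_restrict_space real_quantile_le_iff[OF A]
        intro!: arg_cong[where f = "measure unit_lborel"])
  also have "\<dots> = cdf A x"
    using A.cdf_nonneg A.cdf_bounded_prob by (intro measure_unit_lborel_atMost) auto
  finally show "measure (distr unit_lborel borel (real_quantile (cdf A))) {..x} = measure A {..x}"
    by (simp add: cdf_def)
qed simp

lemma plane_coupling_comonotone:
  assumes "real_distribution A" "real_distribution B"
  shows "plane_coupling A B (comonotone_coupling A B)"
proof -
  note fs = measurable_fst_snd_borel[of "borel :: (real \<times> real) measure", OF refl]
  show ?thesis
    unfolding plane_coupling_def comonotone_coupling_def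
      distr_distr[OF fs(1) measurable_quantile_pair] distr_distr[OF fs(2) measurable_quantile_pair]
    using distr_real_quantile[OF assms(1)] distr_real_quantile[OF assms(2)]
    by (auto simp: comp_def intro!: prob_space.prob_space_distr[OF prob_space_unit_lborel measurable_quantile_pair])
qed

text \<open>Makes the definite description meaningful: existence comes from the quantile
  construction, uniqueness from the fact that products of half-lines are the lower orthants of the
  plane.\<close>

lemma measure_of_cdf2_min:
  assumes "real_distribution A" "real_distribution B"
  shows "measure_of_cdf2 (\<lambda>x y. min (cdf A x) (cdf B y)) = comonotone_coupling A B"
  unfolding measure_of_cdf2_def
proof (rule the_equality)
  show *: "prob_space (comonotone_coupling A B) \<and> sets (comonotone_coupling A B) = sets borel \<and>
    (\<forall>x y. measure (comonotone_coupling A B) ({..x} \<times> {..y}) = min (cdf A x) (cdf B y))"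
    using plane_coupling_comonotone[OF assms] comonotone_coupling_cdf[OF assms]
    by (simp add: plane_coupling_def)
  fix m :: "(real \<times> real) measure"
  assume m: "prob_space m \<and> sets m = sets borel \<and>
    (\<forall>x y. measure m ({..x} \<times> {..y}) = min (cdf A x) (cdf B y))"
  have "{..a} = {..fst a} \<times> {..snd a}" for a :: "real \<times> real"
    by (auto simp: less_eq_prod_def)
  with m * show "m = comonotone_coupling A B"
    by (intro measure_eqI_atMost) simp_all
qed

section \<open>Margins and the multivariate quantile transform\<close>

lemma real_distribution_margin:
  fixes \<mu> :: "(real ^ 'n) measure"
  assumes "prob_space \<mu>" "sets \<mu> = sets borel"
  shows "real_distribution (distr \<mu> borel (\<lambda>x. x $ i))"
proof -
  have "(\<lambda>x. x $ i) \<in> borel_measurable \<mu>"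
    unfolding measurable_cong_sets[OF assms(2) refl] by (rule measurable_vec_nth)
  from prob_space.prob_space_distr[OF assms(1) this] show ?thesis
    by (simp add: real_distribution_def real_distribution_axioms_def)
qed

lemma measurable_quantile_transform:
  "(\<lambda>x :: real ^ 'n. \<chi> i. real_quantile (F i) (x $ i)) \<in> borel_measurable borel"
  by (intro measurable_vec_lambda measurable_compose[OF measurable_vec_nth measurable_real_quantile])

text \<open>Inverse transform sampling in several coordinates: the event that all quantiles are at
  most those of \<open>a\<close> becomes the event that \<open>x $ i\<close> is at most the marginal
  distribution function at \<open>a $ i\<close>, whose probability is a value of
  \<open>C\<close>.\<close>

lemma distr_quantile_transform:
  fixes \<mu> P :: "(real ^ 'n) measure"
  assumes C: "copula C" and P: "prob_space P" "sets P = sets borel"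
      "\<And>u. (\<And>j. u j \<in> {0..1}) \<Longrightarrow> measure P {x. \<forall>j. x $ j \<le> u j} = C (\<chi> j. u j)"
    and \<mu>: "prob_space \<mu>" "sets \<mu> = sets borel"
      "\<And>x. joint_cdf \<mu> x = C (\<chi> i. margin_cdf \<mu> i (x $ i))"
  shows "distr P borel (\<lambda>x. \<chi> i. real_quantile (margin_cdf \<mu> i) (x $ i)) = \<mu>"
proof (rule measure_eqI_atMost)
  interpret P: prob_space P by fact
  let ?T = "\<lambda>x :: real ^ 'n. \<chi> i. real_quantile (margin_cdf \<mu> i) (x $ i)"
  have sp: "space P = UNIV" using sets_eq_imp_space_eq[OF P(2)] by simp
  have nth [measurable]: "(\<lambda>x. x $ i) \<in> borel_measurable P" for i :: 'n
    unfolding measurable_cong_sets[OF P(2) refl] by (rule measurable_vec_nth)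
  have T: "?T \<in> borel_measurable P"
    unfolding measurable_cong_sets[OF P(2) refl] by (rule measurable_quantile_transform)
  show "prob_space (distr P borel ?T)" by (rule P.prob_space_distr[OF T])
  \<comment> \<open>The Galois connection is available for parameters strictly between 0 and 1;
    uniform margins place every coordinate there almost surely.\<close>
  have interior: "AE x in P. \<forall>i. x $ i \<in> {0<..<1}"
  proof (subst AE_all_countable, rule allI)
    fix i
    have "AE u in distr unit_lborel borel (\<lambda>u. u). u \<in> {0<..<1 :: real}"
      by (subst AE_distr_iff) (auto intro!: measurable_restrict_space1 AE_I2 simp: space_restrict_space)
    then have "AE u in distr P borel (\<lambda>x. x $ i). u \<in> {0<..<1 :: real}"
      by (subst distr_nth_copula_measure[OF C P(1,2)]) (auto intro: P(3))
    then show "AE x in P. x $ i \<in> {0<..<1}"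
      by (subst (asm) AE_distr_iff) (auto intro: nth)
  qed
  fix a :: "real ^ 'n"
  have margin: "real_quantile (margin_cdf \<mu> i) u \<le> t \<longleftrightarrow> u \<le> margin_cdf \<mu> i t" if "u \<in> {0<..<1}" for i u t
    unfolding margin_cdf_def using real_quantile_le_iff[OF real_distribution_margin[OF \<mu>(1,2)] that] .
  have range: "margin_cdf \<mu> i t \<in> {0..1}" for i t
  proof -
    interpret M: real_distribution "distr \<mu> borel (\<lambda>x. x $ i)"
      by (rule real_distribution_margin[OF \<mu>(1,2)])
    show ?thesis using M.cdf_nonneg M.cdf_bounded_prob by (simp add: margin_cdf_def)
  qed
  have [measurable]: "{x. \<forall>i. ?T x $ i \<le> a $ i} \<in> sets P" "{x. \<forall>i. x $ i \<le> margin_cdf \<mu> i (a $ i)} \<in> sets P"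
  proof -
    have "{x \<in> space P. \<forall>i. real_quantile (margin_cdf \<mu> i) (x $ i) \<le> a $ i} \<in> sets P"
      "{x \<in> space P. \<forall>i. x $ i \<le> margin_cdf \<mu> i (a $ i)} \<in> sets P" by measurable
    then show "{x. \<forall>i. ?T x $ i \<le> a $ i} \<in> sets P" "{x. \<forall>i. x $ i \<le> margin_cdf \<mu> i (a $ i)} \<in> sets P"
      by (simp_all add: sp)
  qed
  have "measure (distr P borel ?T) {..a} = measure P {x. \<forall>i. ?T x $ i \<le> a $ i}"
    by (subst measure_distr[OF T]) (auto simp: sp less_eq_vec_def intro!: arg_cong[where f = "measure P"])
  also have "\<dots> = measure P {x. \<forall>i. x $ i \<le> margin_cdf \<mu> i (a $ i)}"
  proof (rule P.finite_measure_eq_AE)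
    show "AE x in P. x \<in> {x. \<forall>i. ?T x $ i \<le> a $ i} \<longleftrightarrow> x \<in> {x. \<forall>i. x $ i \<le> margin_cdf \<mu> i (a $ i)}"
      using interior by eventually_elim (simp add: margin)
  qed measurable
  also have "\<dots> = joint_cdf \<mu> a"
    unfolding \<mu>(3) by (rule P(3)) (rule range)
  also have "\<dots> = measure \<mu> {..a}"
    unfolding joint_cdf_def by (auto simp: less_eq_vec_def intro!: arg_cong[where f = "measure \<mu>"])
  finally show "measure (distr P borel ?T) {..a} = measure \<mu> {..a}" .
qed (use \<mu> in simp_all)

section \<open>The Wasserstein distance\<close>

lemma nn_integral_distr_borel:
  "T \<in> borel_measurable M \<Longrightarrow> f \<in> borel_measurable borel \<Longrightarrow>
    integral\<^sup>N (distr M borel T) f = (\<integral>\<^sup>+x. f (T x) \<partial>M)"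
  by (rule nn_integral_distr) simp_all

lemma pnorm_powr: "p \<noteq> 0 \<Longrightarrow> pnorm p x powr p = (\<Sum>i\<in>UNIV. \<bar>x $ i\<bar> powr p)"
  by (simp add: pnorm_def powr_powr sum_nonneg)

text \<open>From the bound of the difference by twice the larger absolute value. The constant is
  crude, but only finiteness is at stake.\<close>

lemma abs_diff_powr_le:
  fixes a b p :: real
  assumes "0 \<le> p"
  shows "\<bar>a - b\<bar> powr p \<le> 2 powr p * (\<bar>a\<bar> powr p + \<bar>b\<bar> powr p)"
proof -
  have "\<bar>a - b\<bar> powr p \<le> (2 * max \<bar>a\<bar> \<bar>b\<bar>) powr p"
    using assms by (intro powr_mono2) auto
  also have "\<dots> = 2 powr p * max \<bar>a\<bar> \<bar>b\<bar> powr p"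
    by (simp add: powr_mult)
  also have "max \<bar>a\<bar> \<bar>b\<bar> powr p \<le> \<bar>a\<bar> powr p + \<bar>b\<bar> powr p"
    by (auto simp: max_def)
  finally show ?thesis by simp
qed

lemma measurable_coordinate_pair:
  fixes Q :: "((real ^ 'n) \<times> (real ^ 'n)) measure"
  assumes "sets Q = sets borel"
  shows "(\<lambda>w. (fst w $ i, snd w $ i)) \<in> borel_measurable Q"
  unfolding measurable_cong_sets[OF assms refl]
  by (intro borel_measurable_continuous_onI continuous_intros)

lemma measurable_abs_diff_powr: "(\<lambda>(x, y). ennreal (\<bar>x - y\<bar> powr p)) \<in> borel_measurable (borel :: (real \<times> real) measure)"
  unfolding borel_prod[symmetric] by measurable

text \<open>The power \<open>p\<close> removes the outer root of \<open>pnorm\<close>, leaving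
  summands that each depend on a single coordinate pair.\<close>

lemma transport_cost_eq_sum:
  fixes Q :: "((real ^ 'n) \<times> (real ^ 'n)) measure"
  assumes p: "p \<noteq> 0" and Q: "sets Q = sets borel"
  shows "(\<integral>\<^sup>+(x, y). ennreal (pnorm p (x - y) powr p) \<partial>Q) =
    (\<Sum>i\<in>UNIV. \<integral>\<^sup>+(x, y). ennreal (\<bar>x - y\<bar> powr p) \<partial>distr Q borel (\<lambda>w. (fst w $ i, snd w $ i)))"
proof -
  note m = measurable_coordinate_pair[OF Q]
  have "(\<integral>\<^sup>+(x, y). ennreal (pnorm p (x - y) powr p) \<partial>Q) =
      (\<integral>\<^sup>+w. (\<Sum>i\<in>UNIV. ennreal (\<bar>fst w $ i - snd w $ i\<bar> powr p)) \<partial>Q)"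
    by (simp add: split_beta' pnorm_powr[OF p] sum_ennreal)
  also have "\<dots> = (\<Sum>i\<in>UNIV. \<integral>\<^sup>+w. ennreal (\<bar>fst w $ i - snd w $ i\<bar> powr p) \<partial>Q)"
    using measurable_compose[OF m measurable_abs_diff_powr] by (intro nn_integral_sum) simp
  also have "\<dots> = (\<Sum>i\<in>UNIV. \<integral>\<^sup>+(x, y). ennreal (\<bar>x - y\<bar> powr p) \<partial>distr Q borel (\<lambda>w. (fst w $ i, snd w $ i)))"
    by (simp add: nn_integral_distr_borel[OF m measurable_abs_diff_powr])
  finally show ?thesis .
qed

lemma plane_coupling_coordinates:
  fixes \<mu> \<nu> :: "(real ^ 'n) measure"
  assumes "Q \<in> couplings \<mu> \<nu>"
  shows "plane_coupling (distr \<mu> borel (\<lambda>x. x $ i)) (distr \<nu> borel (\<lambda>x. x $ i))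
    (distr Q borel (\<lambda>w. (fst w $ i, snd w $ i)))"
proof -
  have Q: "prob_space Q" "sets Q = sets borel" and \<mu>: "\<mu> = distr Q borel fst" and \<nu>: "\<nu> = distr Q borel snd"
    using assms by (auto simp: couplings_def)
  note m = measurable_coordinate_pair[OF Q(2), of i]
  note fs = measurable_fst_snd_borel[of "borel :: (real \<times> real) measure", OF refl]
  show ?thesis
    unfolding plane_coupling_def distr_distr[OF fs(1) m] distr_distr[OF fs(2) m] \<mu> \<nu>
      distr_distr[OF measurable_vec_nth measurable_fst_snd_borel(1)[OF Q(2)]]
      distr_distr[OF measurable_vec_nth measurable_fst_snd_borel(2)[OF Q(2)]]
    using prob_space.prob_space_distr[OF Q(1) m] by (simp add: comp_def)
qed

text \<open>Ensures that \<open>enn2real\<close> in \<open>wasserstein\<close> does not send an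
  infinite value to 0. The cost is dominated by the moments of the two margins.\<close>

lemma transport_cost_finite:
  fixes \<mu> \<nu> :: "(real ^ 'n) measure"
  assumes p: "0 < p" and \<mu>: "\<mu> \<in> prob_moment p" and \<nu>: "\<nu> \<in> prob_moment p" and Q: "Q \<in> couplings \<mu> \<nu>"
  shows "(\<integral>\<^sup>+(x, y). ennreal (pnorm p (x - y) powr p) \<partial>Q) < \<infinity>"
proof -
  have sQ: "sets Q = sets borel" and eq: "\<mu> = distr Q borel fst" "\<nu> = distr Q borel snd"
    using Q by (auto simp: couplings_def)
  note fs = measurable_fst_snd_borel[OF sQ]
  have pm: "(\<lambda>x :: real ^ 'n. pnorm p x powr p) \<in> borel_measurable borel"
  proof -
    have "(\<lambda>x :: real ^ 'n. \<Sum>i\<in>UNIV. \<bar>x $ i\<bar> powr p) \<in> borel_measurable borel" by measurable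
    then show ?thesis using p by (simp add: pnorm_powr)
  qed
  then have m: "(\<lambda>x :: real ^ 'n. ennreal (pnorm p x powr p)) \<in> borel_measurable borel"
    by measurable
  have moment: "(\<integral>\<^sup>+x. ennreal (pnorm p x powr p) \<partial>\<rho>) < \<infinity>" if "\<rho> \<in> prob_moment p" for \<rho> :: "(real ^ 'n) measure"
    using that by (auto simp: prob_moment_def integrable_iff_bounded)
  have bound: "pnorm p (x - y) powr p \<le> 2 powr p * (pnorm p x powr p + pnorm p y powr p)" for x y :: "real ^ 'n"
    using p abs_diff_powr_le[of p]
    by (simp add: pnorm_powr sum_distrib_left sum.distrib[symmetric] distrib_left[symmetric] sum_mono)
  have "(\<integral>\<^sup>+(x, y). ennreal (pnorm p (x - y) powr p) \<partial>Q) \<le>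
      (\<integral>\<^sup>+w. ennreal (2 powr p) * (ennreal (pnorm p (fst w) powr p) + ennreal (pnorm p (snd w) powr p)) \<partial>Q)"
    unfolding split_beta'
    by (intro nn_integral_mono) (simp add: bound ennreal_leI flip: ennreal_plus ennreal_mult')
  also have "\<dots> = ennreal (2 powr p) * ((\<integral>\<^sup>+w. ennreal (pnorm p (fst w) powr p) \<partial>Q)
      + (\<integral>\<^sup>+w. ennreal (pnorm p (snd w) powr p) \<partial>Q))"
    using measurable_compose[OF fs(1) m] measurable_compose[OF fs(2) m]
    by (simp add: nn_integral_cmult nn_integral_add)
  also have "\<dots> = ennreal (2 powr p) * ((\<integral>\<^sup>+x. ennreal (pnorm p x powr p) \<partial>\<mu>)
      + (\<integral>\<^sup>+x. ennreal (pnorm p x powr p) \<partial>\<nu>))"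
    unfolding eq nn_integral_distr_borel[OF fs(1) m] nn_integral_distr_borel[OF fs(2) m] ..
  also have "\<dots> < \<infinity>"
    using moment[OF \<mu>] moment[OF \<nu>] by (simp add: ennreal_mult_less_top)
  finally show ?thesis .
qed

text \<open>One random vector distributed according to the common copula feeds both quantile
  transforms, so each coordinate pair is driven by a single uniform variable.\<close>

lemma ex_coupling_comonotone_margins:
  fixes \<mu> \<nu> :: "(real ^ 'n) measure"
  assumes \<mu>: "prob_space \<mu>" "sets \<mu> = sets borel" and \<nu>: "prob_space \<nu>" "sets \<nu> = sets borel"
    and share: "share_copula \<mu> \<nu>"
  shows "\<exists>Q\<in>couplings \<mu> \<nu>. \<forall>i. distr Q borel (\<lambda>w. (fst w $ i, snd w $ i)) =
      comonotone_coupling (distr \<mu> borel (\<lambda>x. x $ i)) (distr \<nu> borel (\<lambda>x. x $ i))"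
proof -
  obtain C where C: "copula C"
    and C\<mu>: "\<And>x. joint_cdf \<mu> x = C (\<chi> i. margin_cdf \<mu> i (x $ i))"
    and C\<nu>: "\<And>x. joint_cdf \<nu> x = C (\<chi> i. margin_cdf \<nu> i (x $ i))"
    using share unfolding share_copula_def by blast
  show ?thesis
  proof (rule ex_measure_copula[OF C])
    fix P :: "(real ^ 'n) measure"
    assume P: "prob_space P" "sets P = sets borel"
      "\<And>u. (\<And>j. u j \<in> {0..1}) \<Longrightarrow> measure P {x. \<forall>j. x $ j \<le> u j} = C (\<chi> j. u j)"
    let ?S = "\<lambda>x :: real ^ 'n. \<chi> i. real_quantile (margin_cdf \<mu> i) (x $ i)"
    let ?T = "\<lambda>x :: real ^ 'n. \<chi> i. real_quantile (margin_cdf \<nu> i) (x $ i)"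
    let ?Q = "distr P borel (\<lambda>x. (?S x, ?T x))"
    have nth: "(\<lambda>x. x $ i) \<in> borel_measurable P" for i :: 'n
      unfolding measurable_cong_sets[OF P(2) refl] by (rule measurable_vec_nth)
    have "(\<lambda>x. (?S x, ?T x)) \<in> measurable borel (borel \<Otimes>\<^sub>M borel)"
      by (intro measurable_Pair measurable_quantile_transform)
    then have ST: "(\<lambda>x. (?S x, ?T x)) \<in> borel_measurable P"
      unfolding measurable_cong_sets[OF P(2) refl] borel_prod .
    note fs = measurable_fst_snd_borel[of "borel :: ((real ^ 'n) \<times> (real ^ 'n)) measure", OF refl]
    have S: "distr P borel ?S = \<mu>"
      by (rule distr_quantile_transform[OF C P(1,2) _ \<mu> C\<mu>]) (rule P(3))
    have T: "distr P borel ?T = \<nu>"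
      by (rule distr_quantile_transform[OF C P(1,2) _ \<nu> C\<nu>]) (rule P(3))
    have "?Q \<in> couplings \<mu> \<nu>"
      unfolding couplings_def
      using prob_space.prob_space_distr[OF P(1) ST] S T
      by (simp add: distr_distr[OF fs(1) ST] distr_distr[OF fs(2) ST] comp_def)
    moreover have "distr ?Q borel (\<lambda>w. (fst w $ i, snd w $ i)) =
        comonotone_coupling (distr \<mu> borel (\<lambda>x. x $ i)) (distr \<nu> borel (\<lambda>x. x $ i))" for i
    proof -
      let ?g = "\<lambda>u. (real_quantile (margin_cdf \<mu> i) u, real_quantile (margin_cdf \<nu> i) u)"
      have "?g \<in> measurable borel (borel \<Otimes>\<^sub>M borel)" by measurable
      then have g: "?g \<in> borel_measurable borel" by (simp add: borel_prod)
      have id: "(\<lambda>u :: real. u) \<in> borel_measurable unit_lborel"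
        by (intro measurable_restrict_space1) simp
      \<comment> \<open>The pair depends on the vector only through \<open>x $ i\<close>, whose law
        is uniform.\<close>
      have "distr ?Q borel (\<lambda>w. (fst w $ i, snd w $ i)) = distr (distr P borel (\<lambda>x. x $ i)) borel ?g"
        by (simp add: distr_distr[OF measurable_coordinate_pair[OF refl] ST] distr_distr[OF g nth] comp_def)
      also have "distr P borel (\<lambda>x. x $ i) = distr unit_lborel borel (\<lambda>u. u)"
        by (rule distr_nth_copula_measure[OF C P(1,2)]) (rule P(3))
      also have "distr \<dots> borel ?g = comonotone_coupling (distr \<mu> borel (\<lambda>x. x $ i)) (distr \<nu> borel (\<lambda>x. x $ i))"
        unfolding distr_distr[OF g id] by (simp add: comonotone_coupling_def margin_cdf_def comp_def)
      finally show ?thesis .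
    qed
    ultimately show ?thesis by blast
  qed
qed

text \<open>The end points, where \<open>quantile_vec\<close> may carry the default value 0 of an
  infinite quantile, form a null set.\<close>

lemma nn_integral_unit_interval_eq:
  fixes f :: "real \<Rightarrow> ennreal"
  assumes "f \<in> borel_measurable borel"
  shows "(\<integral>\<^sup>+u\<in>{0..1}. f u \<partial>lborel) = (\<integral>\<^sup>+u. f u \<partial>unit_lborel)"
proof -
  have "(\<integral>\<^sup>+u\<in>{0..1}. f u \<partial>lborel) = (\<integral>\<^sup>+u\<in>{0<..<1}. f u \<partial>lborel)"
  proof (rule nn_integral_cong_AE)
    show "AE u in lborel. f u * indicator {0..1} u = f u * indicator {0<..<1} u"
      using AE_lborel_singleton[of 0] AE_lborel_singleton[of 1]
      by eventually_elim (auto simp: indicator_def)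
  qed
  also have "\<dots> = (\<integral>\<^sup>+u. f u \<partial>unit_lborel)"
    by (subst nn_integral_restrict_space) auto
  finally show ?thesis .
qed

theorem theorem2p6:
  fixes p :: real and \<mu> \<nu> :: "(real ^ 'n) measure"
  assumes "1 \<le> p"
    and "\<mu> \<in> prob_moment p" and "\<nu> \<in> prob_moment p"
    and "share_copula \<mu> \<nu>"
  shows "ennreal (wasserstein p \<mu> \<nu> powr p) =
      (\<Sum>i\<in>UNIV. \<integral>\<^sup>+(x, y). ennreal (\<bar>x - y\<bar> powr p)
         \<partial>measure_of_cdf2 (\<lambda>x y. min (margin_cdf \<mu> i x) (margin_cdf \<nu> i y)))
    \<and> (\<Sum>i\<in>UNIV. \<integral>\<^sup>+(x, y). ennreal (\<bar>x - y\<bar> powr p)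
         \<partial>measure_of_cdf2 (\<lambda>x y. min (margin_cdf \<mu> i x) (margin_cdf \<nu> i y))) =
      (\<integral>\<^sup>+u\<in>{0..1}. ennreal (pnorm p (quantile_vec \<mu> u - quantile_vec \<nu> u) powr p) \<partial>lborel)"
proof -
  have p: "p \<noteq> 0" "0 < p" using assms(1) by auto
  have \<mu>: "prob_space \<mu>" "sets \<mu> = sets borel" and \<nu>: "prob_space \<nu>" "sets \<nu> = sets borel"
    using assms(2,3) by (auto simp: prob_moment_def)
  let ?A = "\<lambda>i. distr \<mu> borel (\<lambda>x. x $ i)" and ?B = "\<lambda>i. distr \<nu> borel (\<lambda>x. x $ i)"
  let ?c = "\<lambda>(x, y). ennreal (\<bar>x - y\<bar> powr p)"
  note A = real_distribution_margin[OF \<mu>] and B = real_distribution_margin[OF \<nu>]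
  define V where "V = (\<Sum>i\<in>UNIV. \<integral>\<^sup>+w. ?c w \<partial>comonotone_coupling (?A i) (?B i))"
  have V: "(\<Sum>i\<in>UNIV. \<integral>\<^sup>+(x, y). ennreal (\<bar>x - y\<bar> powr p)
      \<partial>measure_of_cdf2 (\<lambda>x y. min (margin_cdf \<mu> i x) (margin_cdf \<nu> i y))) = V"
    unfolding V_def margin_cdf_def measure_of_cdf2_min[OF A B] ..
  have lower: "V \<le> (\<integral>\<^sup>+(x, y). ennreal (pnorm p (x - y) powr p) \<partial>Q)" if Q: "Q \<in> couplings \<mu> \<nu>" for Q
  proof -
    have "sets Q = sets borel" using Q by (simp add: couplings_def)
    then show ?thesis
      unfolding V_def by (subst transport_cost_eq_sum[OF p(1)], simp, intro sum_mono)
        (rule comonotone_coupling_optimal[OF assms(1) plane_coupling_comonotone[OF A B]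
          plane_coupling_coordinates[OF Q] comonotone_coupling_cdf[OF A B]])
  qed
  obtain Q where Q: "Q \<in> couplings \<mu> \<nu>"
    and Q_margins: "\<And>i. distr Q borel (\<lambda>w. (fst w $ i, snd w $ i)) = comonotone_coupling (?A i) (?B i)"
    using ex_coupling_comonotone_margins[OF \<mu> \<nu> assms(4)] by blast
  have Q_cost: "(\<integral>\<^sup>+(x, y). ennreal (pnorm p (x - y) powr p) \<partial>Q) = V"
    using Q transport_cost_eq_sum[OF p(1), of Q] by (simp add: couplings_def V_def Q_margins)
  have "(INF \<pi>\<in>couplings \<mu> \<nu>. \<integral>\<^sup>+(x, y). ennreal (pnorm p (x - y) powr p) \<partial>\<pi>) = V"
    using INF_lower[OF Q, of "\<lambda>\<pi>. \<integral>\<^sup>+(x, y). ennreal (pnorm p (x - y) powr p) \<partial>\<pi>"] lower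
    unfolding Q_cost by (intro antisym INF_greatest)
  \<comment> \<open>Finiteness makes \<open>enn2real\<close> in \<open>wasserstein\<close> faithful,
    after which the exponents \<open>1 / p\<close> and \<open>p\<close> cancel.\<close>
  moreover have "V < \<infinity>"
    using transport_cost_finite[OF p(2) assms(2,3) Q] unfolding Q_cost .
  ultimately have W: "ennreal (wasserstein p \<mu> \<nu> powr p) = V"
    using p by (simp add: wasserstein_def powr_powr)
  have "(\<integral>\<^sup>+u\<in>{0..1}. ennreal (pnorm p (quantile_vec \<mu> u - quantile_vec \<nu> u) powr p) \<partial>lborel) =
      (\<integral>\<^sup>+u\<in>{0..1}. (\<Sum>i\<in>UNIV. ?c (real_quantile (cdf (?A i)) u, real_quantile (cdf (?B i)) u)) \<partial>lborel)"
    by (simp add: pnorm_powr[OF p(1)] quantile_vec_def margin_cdf_def sum_ennreal)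
  also have "\<dots> = (\<integral>\<^sup>+u. (\<Sum>i\<in>UNIV. ?c (real_quantile (cdf (?A i)) u, real_quantile (cdf (?B i)) u)) \<partial>unit_lborel)"
    by (rule nn_integral_unit_interval_eq) simp
  also have "\<dots> = (\<Sum>i\<in>UNIV. \<integral>\<^sup>+u. ?c (real_quantile (cdf (?A i)) u, real_quantile (cdf (?B i)) u) \<partial>unit_lborel)"
    by (intro nn_integral_sum measurable_compose[OF measurable_quantile_pair measurable_abs_diff_powr])
  \<comment> \<open>Each summand is the cost under \<open>comonotone_coupling\<close>, pulled back
    along the quantile pair.\<close>
  also have "\<dots> = V"
    unfolding V_def comonotone_coupling_def
    by (simp add: nn_integral_distr_borel[OF measurable_quantile_pair measurable_abs_diff_powr])
  finally show ?thesis unfolding V W by simp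
qed

end
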